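(* Let $E$ and $F$ be Banach spaces with $E$ finite-dimensional. Then: (i) $K_G(E,F^* )=K_G(E,F)$. (ii) $K_G(E,F)\le\min\{\rho(E,F),\rho(E,F^* )\}$. (iii) $K_G(\ell_2^n,F)=\rho(\ell_2^n,F)$ for every $n\geq 1$.
   Context: All Banach spaces are real. $E\check\otimes F$ and $E\hat\otimes F$ denote the injective and projective tensor products. For $E$ finite-dimensional and $F$ a Banach space, $$K_G(E,F)=\sup\{\|A\otimes\mathrm{id}_F\|_{E\check\otimes F\to E^*\hat\otimes F}:\ A:E\to E^*\text{ linear},\ \|A\|_{E\to E^*}\le1\},$$ $$\rho(E,F)=\|\mathrm{id}_E\otimes\mathrm{id}_F\|_{E\check\otimes F\to E\hat\otimes F}.$$ *)

theory Defs
  imports "HOL-Analysis.Analysis"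
begin

section \<open>The algebraic tensor product\<close>

text \<open>
  A list \<open>[(x\<^sub>1, y\<^sub>1), \<dots>, (x\<^sub>n, y\<^sub>n)]\<close> stands for the formal sum of the \<open>x\<^sub>i \<otimes> y\<^sub>i\<close>. Two formal sums are
  the same tensor iff every (algebraic, not necessarily continuous) bilinear form takes the same
  value on both. The universal property is proved in \<open>tensor_universal\<close> below.
\<close>

definition bilin_sum :: "('a \<Rightarrow> 'b \<Rightarrow> 'c::comm_monoid_add) \<Rightarrow> ('a \<times> 'b) list \<Rightarrow> 'c" where
  "bilin_sum B ps = (\<Sum>(x, y)\<leftarrow>ps. B x y)"

lemma bilin_sum_simps [simp]:
  "bilin_sum B [] = 0"
  "bilin_sum B (p # ps) = B (fst p) (snd p) + bilin_sum B ps"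
  "bilin_sum B (ps @ qs) = bilin_sum B ps + bilin_sum B qs"
  by (simp_all add: bilin_sum_def case_prod_beta)

lemma bilin_sum_map: "bilin_sum B (map (map_prod f g) ps) = bilin_sum (\<lambda>x y. B (f x) (g y)) ps"
  by (induction ps) auto

lemma bilin_sum_scale:
  fixes B :: "'a::real_vector \<Rightarrow> 'b::real_vector \<Rightarrow> 'c::real_vector"
  assumes "bilinear B"
  shows "bilin_sum B (map (map_prod ((*\<^sub>R) c) id) ps) = c *\<^sub>R bilin_sum B ps"
  using assms by (induction ps) (auto simp: bilinear_lmul scaleR_add_right)

lemma bilinear_compose:
  assumes "bilinear B" "linear f" "linear g"
  shows "bilinear (\<lambda>x y. B (f x) (g y))"
  using assms unfolding bilinear_def linear_iff by simp

definition tensor_rel :: "('a::real_vector \<times> 'b::real_vector) list \<Rightarrow> ('a \<times> 'b) list \<Rightarrow> bool" where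
  "tensor_rel ps qs \<longleftrightarrow> (\<forall>B :: 'a \<Rightarrow> 'b \<Rightarrow> real. bilinear B \<longrightarrow> bilin_sum B ps = bilin_sum B qs)"

quotient_type (overloaded) ('a, 'b) tensor = "('a::real_vector \<times> 'b::real_vector) list" / tensor_rel
  by (rule equivpI) (auto simp: reflp_def symp_def transp_def tensor_rel_def)

instantiation tensor :: (real_vector, real_vector) real_vector
begin

lift_definition zero_tensor :: "('a, 'b) tensor" is "[]" .

lift_definition plus_tensor :: "('a, 'b) tensor \<Rightarrow> ('a, 'b) tensor \<Rightarrow> ('a, 'b) tensor" is "(@)"
  by (auto simp: tensor_rel_def)

lift_definition scaleR_tensor :: "real \<Rightarrow> ('a, 'b) tensor \<Rightarrow> ('a, 'b) tensor"
  is "\<lambda>c. map (map_prod ((*\<^sub>R) c) id)"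
  by (auto simp: tensor_rel_def bilin_sum_scale)

definition uminus_tensor :: "('a, 'b) tensor \<Rightarrow> ('a, 'b) tensor" where
  "uminus_tensor u = (-1) *\<^sub>R u"

definition minus_tensor :: "('a, 'b) tensor \<Rightarrow> ('a, 'b) tensor \<Rightarrow> ('a, 'b) tensor" where
  "minus_tensor u v = u + (-1) *\<^sub>R v"

instance
proof
  fix a b :: real and u v w :: "('a, 'b) tensor"
  show "u + v + w = u + (v + w)" "u + v = v + u" "0 + u = u"
    by (transfer, simp add: tensor_rel_def)+
  show "- u + u = 0"
    unfolding uminus_tensor_def by (transfer, simp add: tensor_rel_def bilin_sum_scale)
  show "u - v = u + - v"
    by (simp only: uminus_tensor_def minus_tensor_def)
  show "a *\<^sub>R (u + v) = a *\<^sub>R u + a *\<^sub>R v"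
    by (transfer, simp add: tensor_rel_def)
  show "(a + b) *\<^sub>R u = a *\<^sub>R u + b *\<^sub>R u"
    by (transfer, simp add: tensor_rel_def bilin_sum_scale distrib_right)
  show "a *\<^sub>R b *\<^sub>R u = (a * b) *\<^sub>R u"
    by (transfer, simp add: tensor_rel_def bilin_sum_scale del: map_map)
  show "1 *\<^sub>R u = u"
    by (transfer, simp add: tensor_rel_def bilin_sum_scale)
qed

end

lift_definition tensor_elem :: "'a::real_vector \<Rightarrow> 'b::real_vector \<Rightarrow> ('a, 'b) tensor" (infixr \<open>\<otimes>\<close> 75)
  is "\<lambda>x y. [(x, y)]" .

lemma bilinear_tensor_elem: "bilinear (\<otimes>)"
  unfolding bilinear_def
  by (auto intro!: linearI; transfer;
      auto simp: tensor_rel_def bilinear_ladd bilinear_radd bilinear_lmul bilinear_rmul)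

lemma tensor_exhaust:
  obtains (formal_sum) ps where "u = abs_tensor ps"
  by (induction u rule: tensor.abs_induct) blast

lemma abs_tensor_eq: "abs_tensor ps = bilin_sum (\<otimes>) ps"
proof (induction ps)
  case Nil
  show ?case by (simp add: zero_tensor_def)
next
  case (Cons p ps)
  have "abs_tensor (p # ps) = fst p \<otimes> snd p + abs_tensor ps"
    by (simp add: tensor_elem.abs_eq plus_tensor.abs_eq)
  with Cons show ?case by simp
qed

definition tensor_lift ::
  "('a::real_vector \<Rightarrow> 'b::real_vector \<Rightarrow> 'c::real_vector) \<Rightarrow> ('a, 'b) tensor \<Rightarrow> 'c" where
  "tensor_lift B u = bilin_sum B (rep_tensor u)"

lemma bilin_sum_linear:
  assumes "linear f"
  shows "f (bilin_sum B ps) = bilin_sum (\<lambda>x y. f (B x y)) ps"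
  using assms by (induction ps) (auto simp: linear_add linear_0)

lemma linear_functional_separates:
  fixes z :: "'c::real_vector"
  assumes "\<And>f :: 'c \<Rightarrow> real. linear f \<Longrightarrow> f z = 0"
  shows "z = 0"
proof (rule ccontr)
  assume "z \<noteq> 0"
  then have "independent {z}" by simp
  from linear_independent_extend[OF this, of "\<lambda>_. 1::real"] assms show False
    by force
qed

lemma tensor_rel_bilinear:
  fixes B :: "'a::real_vector \<Rightarrow> 'b::real_vector \<Rightarrow> 'c::real_vector"
  assumes "tensor_rel ps qs" "bilinear B"
  shows "bilin_sum B ps = bilin_sum B qs"
proof -
  have "f (bilin_sum B ps - bilin_sum B qs) = 0" if "linear f" for f :: "'c \<Rightarrow> real"
  proof -
    have "bilinear (\<lambda>x y. f (B x y))"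
      using assms(2) that unfolding bilinear_def linear_iff by simp
    with assms(1) that show ?thesis
      by (simp add: tensor_rel_def linear_diff bilin_sum_linear)
  qed
  then have "bilin_sum B ps - bilin_sum B qs = 0"
    by (rule linear_functional_separates)
  then show ?thesis by simp
qed

lemma tensor_lift_abs:
  assumes "bilinear B"
  shows "tensor_lift B (abs_tensor ps) = bilin_sum B ps"
  unfolding tensor_lift_def
  by (rule tensor_rel_bilinear[OF _ assms])
    (meson Quotient3_tensor Quotient3_rep_abs equivp_reflp tensor_equivp)

lemma tensor_lift_elem [simp]: "bilinear B \<Longrightarrow> tensor_lift B (x \<otimes> y) = B x y"
  by (simp add: tensor_lift_abs tensor_elem.abs_eq)

lemma linear_tensor_lift:
  assumes "bilinear B"
  shows "linear (tensor_lift B)"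
proof (rule linearI)
  fix u v :: "('a, 'b) tensor" and c :: real
  show "tensor_lift B (u + v) = tensor_lift B u + tensor_lift B v"
    by (cases u rule: tensor_exhaust, cases v rule: tensor_exhaust)
      (simp add: plus_tensor.abs_eq tensor_lift_abs assms)
  show "tensor_lift B (c *\<^sub>R u) = c *\<^sub>R tensor_lift B u"
    by (cases u rule: tensor_exhaust) (simp add: scaleR_tensor.abs_eq tensor_lift_abs assms bilin_sum_scale)
qed

theorem tensor_universal:
  assumes "bilinear B"
  shows "\<exists>!T. linear T \<and> (\<forall>x y. T (x \<otimes> y) = B x y)"
proof (rule ex1I[of _ "tensor_lift B"])
  show "linear (tensor_lift B) \<and> (\<forall>x y. tensor_lift B (x \<otimes> y) = B x y)"
    using assms by (simp add: linear_tensor_lift)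
  fix T assume T: "linear T \<and> (\<forall>x y. T (x \<otimes> y) = B x y)"
  show "T = tensor_lift B"
  proof
    fix u show "T u = tensor_lift B u"
      using T by (cases u rule: tensor_exhaust)
        (simp add: tensor_lift_abs assms, simp add: abs_tensor_eq bilin_sum_linear)
  qed
qed

definition tensor_map ::
  "('a::real_vector \<Rightarrow> 'c::real_vector) \<Rightarrow> ('b::real_vector \<Rightarrow> 'd::real_vector)
    \<Rightarrow> ('a, 'b) tensor \<Rightarrow> ('c, 'd) tensor" where
  "tensor_map f g = tensor_lift (\<lambda>x y. f x \<otimes> g y)"

lemma tensor_map_elem [simp]:
  "linear f \<Longrightarrow> linear g \<Longrightarrow> tensor_map f g (x \<otimes> y) = f x \<otimes> g y"
  by (simp add: tensor_map_def bilinear_compose[OF bilinear_tensor_elem])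

lemma linear_tensor_map: "linear f \<Longrightarrow> linear g \<Longrightarrow> linear (tensor_map f g)"
  by (simp add: tensor_map_def linear_tensor_lift bilinear_compose[OF bilinear_tensor_elem])


section \<open>Injective and projective norms\<close>

definition inj_norm :: "('a::real_normed_vector, 'b::real_normed_vector) tensor \<Rightarrow> real" where
  "inj_norm u = (SUP (\<xi>, \<eta>) \<in> {\<xi> :: 'a \<Rightarrow>\<^sub>L real. norm \<xi> \<le> 1} \<times> {\<eta> :: 'b \<Rightarrow>\<^sub>L real. norm \<eta> \<le> 1}.
     \<bar>tensor_lift (\<lambda>x y. blinfun_apply \<xi> x * blinfun_apply \<eta> y) u\<bar>)"

definition proj_norm :: "('a::real_normed_vector, 'b::real_normed_vector) tensor \<Rightarrow> real" where
  "proj_norm u = Inf {(\<Sum>(x, y)\<leftarrow>ps. norm x * norm y) | ps. u = (\<Sum>(x, y)\<leftarrow>ps. x \<otimes> y)}"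

text \<open>The real-valued supremum and infimum above are those of bounded, nonempty sets:\<close>

lemma bilinear_blinfun_mult:
  "bilinear (\<lambda>x y. blinfun_apply \<xi> x * (blinfun_apply \<eta> y :: real))"
  unfolding bilinear_def
  by (auto intro!: linearI simp: blinfun.add_right blinfun.scaleR_right algebra_simps)

lemma inj_norm_bdd_above:
  fixes u :: "('a::real_normed_vector, 'b::real_normed_vector) tensor"
  shows "bdd_above ((\<lambda>(\<xi>, \<eta>). \<bar>tensor_lift (\<lambda>x y. blinfun_apply \<xi> x * blinfun_apply \<eta> y) u\<bar>) `
    ({\<xi> :: 'a \<Rightarrow>\<^sub>L real. norm \<xi> \<le> 1} \<times> {\<eta> :: 'b \<Rightarrow>\<^sub>L real. norm \<eta> \<le> 1}))"
proof (cases u rule: tensor_exhaust)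
  case (formal_sum ps)
  have bound: "\<bar>bilin_sum (\<lambda>x y. blinfun_apply \<xi> x * blinfun_apply \<eta> y) ps\<bar>
      \<le> bilin_sum (\<lambda>x y. norm x * norm y) ps"
    if "norm \<xi> \<le> 1" "norm \<eta> \<le> 1" for \<xi> :: "'a \<Rightarrow>\<^sub>L real" and \<eta> :: "'b \<Rightarrow>\<^sub>L real"
  proof (induction ps)
    case (Cons p ps)
    have "\<bar>blinfun_apply \<xi> (fst p)\<bar> \<le> norm (fst p)"
      using norm_blinfun[of \<xi> "fst p"] mult_right_mono[OF that(1), of "norm (fst p)"] by simp
    moreover have "\<bar>blinfun_apply \<eta> (snd p)\<bar> \<le> norm (snd p)"
      using norm_blinfun[of \<eta> "snd p"] mult_right_mono[OF that(2), of "norm (snd p)"] by simp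
    ultimately have "\<bar>blinfun_apply \<xi> (fst p) * blinfun_apply \<eta> (snd p)\<bar> \<le> norm (fst p) * norm (snd p)"
      unfolding abs_mult by (intro mult_mono) auto
    with Cons show ?case by simp
  qed simp
  show ?thesis
    by (rule bdd_aboveI[of _ "bilin_sum (\<lambda>x y. norm x * norm y) ps"])
      (auto simp: formal_sum tensor_lift_abs bilinear_blinfun_mult bound)
qed

lemma proj_norm_nonempty:
  "{(\<Sum>(x, y)\<leftarrow>ps. norm x * norm y) | ps. u = (\<Sum>(x, y)\<leftarrow>ps. x \<otimes> y)} \<noteq> {}"
  by (cases u rule: tensor_exhaust) (auto simp: abs_tensor_eq bilin_sum_def)

lemma proj_norm_bdd_below:
  "bdd_below {(\<Sum>(x, y)\<leftarrow>ps. norm x * norm y) | ps. u = (\<Sum>(x, y)\<leftarrow>ps. x \<otimes> y)}"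
  by (rule bdd_belowI[of _ 0]) (auto intro!: sum_list_nonneg)


section \<open>The constants\<close>

text \<open>
  Operator norms are taken in \<open>[0, \<infinity>]\<close>. They are computed on the algebraic tensor product, which is
  dense in its completion (and equal to it when one of the factors is finite-dimensional).
  In \<open>K_G\<close>, \<open>A\<close> ranges over the bounded operators, which for finite-dimensional \<open>'e\<close> are all the
  linear maps.
\<close>

definition inj_proj_opnorm ::
  "(('a::real_normed_vector, 'b::real_normed_vector) tensor
    \<Rightarrow> ('c::real_normed_vector, 'd::real_normed_vector) tensor) \<Rightarrow> ennreal" where
  "inj_proj_opnorm T = (SUP u \<in> {u. inj_norm u \<le> 1}. ennreal (proj_norm (T u)))"

definition K_G :: "'e::banach itself \<Rightarrow> 'f::banach itself \<Rightarrow> ennreal" where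
  "K_G _ _ = (SUP A \<in> {A :: 'e \<Rightarrow>\<^sub>L ('e \<Rightarrow>\<^sub>L real). norm A \<le> 1}.
     inj_proj_opnorm (tensor_map (blinfun_apply A) (id :: 'f \<Rightarrow> 'f)))"

definition rho :: "'e::banach itself \<Rightarrow> 'f::banach itself \<Rightarrow> ennreal" where
  "rho _ _ = inj_proj_opnorm (tensor_map (id :: 'e \<Rightarrow> 'e) (id :: 'f \<Rightarrow> 'f))"

definition finite_dim :: "'e::real_vector itself \<Rightarrow> bool" where
  "finite_dim _ \<longleftrightarrow> (\<exists>B :: 'e set. finite B \<and> span B = UNIV)"

end

theory Submission
  imports Defs
begin

text \<open>
  Both sides of (i) are the same supremum. A bilinear form \<open>A\<close> on \<open>E\<close> pairs \<open>u \<in> E \<otimes> F*\<close> with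
  \<open>w \<in> E \<otimes> F\<close> by sending \<open>x \<otimes> g\<close> and \<open>x' \<otimes> y\<close> to \<open>A x x' * g y\<close>. The constants of \<open>(E, F*)\<close> and of
  \<open>(E, F)\<close> are both the supremum of this number over \<open>\<parallel>A\<parallel> \<le> 1\<close> and over \<open>u\<close> and \<open>w\<close> of injective norm
  at most 1: the former evaluates \<open>A \<otimes> id\<close> on \<open>u\<close> and lets \<open>w\<close> compute the projective norm, the
  latter evaluates the transpose of \<open>A\<close> on \<open>w\<close> and lets \<open>u\<close> compute the projective norm.
  Transposition preserves \<open>\<parallel>A\<parallel> \<le> 1\<close>, so the two agree.

  This rests on two duality facts for finite-dimensional \<open>E\<close>. The projective norm on \<open>E* \<otimes> F\<close> is
  computed by the injective unit ball of \<open>E \<otimes> F*\<close> (\<open>proj_norm_attained_by_pairing\<close>): a functional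
  dominated by the projective norm is a bounded bilinear form on \<open>E* \<times> F\<close>, and expanding its first
  argument in a basis writes it as a tensor. The projective norm on \<open>E* \<otimes> F*\<close> is computed by the
  injective unit ball of \<open>E \<otimes> F\<close> itself, a predual, rather than of \<open>E \<otimes> F**\<close>
  (\<open>proj_norm_le_of_pairing\<close>). This is a form of local reflexivity. A finite net of the dual ball
  embeds \<open>E \<otimes> F\<close> almost isometrically into finite sequences in \<open>F\<close> with the supremum norm. By
  Hahn-Banach the functional \<open>w \<mapsto> \<langle>v, w\<rangle>\<close> extends to these sequences, where it is a tuple
  \<open>(\<eta>\<^sub>i)\<close> of functionals whose norms have a controlled sum. So \<open>v\<close> is the sum of the
  \<open>\<xi>\<^sub>i \<otimes> \<eta>\<^sub>i\<close> with \<open>\<xi>\<^sub>i\<close> in the net, and this representation bounds its projective norm.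

  For (ii), \<open>A \<otimes> id\<close> does not increase the projective norm when \<open>\<parallel>A\<parallel> \<le> 1\<close>; this gives the bound for
  \<open>F\<close>, and (i) transfers it from \<open>F*\<close>. For (iii), the Riesz isometry of a Euclidean space with its
  dual is an admissible \<open>A\<close> whose inverse is also a contraction, so it preserves the projective norm.
\<close>

section \<open>The Hahn-Banach theorem\<close>

definition sublinear :: "('a::real_vector \<Rightarrow> real) \<Rightarrow> bool" where
  "sublinear p \<longleftrightarrow> (\<forall>x y. p (x + y) \<le> p x + p y) \<and> (\<forall>c\<ge>0. \<forall>x. p (c *\<^sub>R x) = c * p x)"

lemma sublinear_add: "sublinear p \<Longrightarrow> p (x + y) \<le> p x + p y"
  and sublinear_scale: "sublinear p \<Longrightarrow> 0 \<le> c \<Longrightarrow> p (c *\<^sub>R x) = c * p x"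
  by (auto simp: sublinear_def)

lemma sublinear_zero: "sublinear p \<Longrightarrow> p 0 = 0"
  using sublinear_scale[of p 0 0] by simp

lemma sublinear_minus: "sublinear p \<Longrightarrow> - p (- x) \<le> p x"
  using sublinear_add[of p x "- x"] by (simp add: sublinear_zero)

lemma sublinearI:
  assumes add: "\<And>x y. p (x + y) \<le> p x + p y"
    and scale: "\<And>c x. 0 < c \<Longrightarrow> p (c *\<^sub>R x) \<le> c * p x"
    and zero: "p 0 \<le> 0"
  shows "sublinear p"
  unfolding sublinear_def
proof (intro conjI allI impI add)
  fix c :: real and x
  assume "0 \<le> c"
  show "p (c *\<^sub>R x) = c * p x"
  proof (cases "c = 0")
    case True
    then show ?thesis using zero add[of 0 0] by simp
  next
    case False
    with \<open>0 \<le> c\<close> have c: "0 < c" by simp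
    have "p x \<le> inverse c * p (c *\<^sub>R x)"
      using scale[of "inverse c" "c *\<^sub>R x"] c by simp
    with c have "c * p x \<le> p (c *\<^sub>R x)"
      by (simp add: field_simps)
    with scale[OF c, of x] show ?thesis by simp
  qed
qed

text \<open>
  The three infima of the Hahn-Banach proof (along a chain of functionals, along a ray, and along
  the range of a linear map) are all sublinear for the same reason: any two indices can be combined
  into one that beats their sum, and any index can be rescaled.
\<close>

lemma sublinear_INF:
  assumes bdd: "\<And>x. bdd_below ((\<lambda>i. h i x) ` I)"
    and add: "\<And>i j x y. i \<in> I \<Longrightarrow> j \<in> I \<Longrightarrow> \<exists>k\<in>I. h k (x + y) \<le> h i x + h j y"
    and scale: "\<And>c i x. 0 < c \<Longrightarrow> i \<in> I \<Longrightarrow> \<exists>k\<in>I. h k (c *\<^sub>R x) \<le> c * h i x"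
    and zero: "\<exists>i\<in>I. h i 0 \<le> (0::real)"
  shows "sublinear (\<lambda>x. INF i\<in>I. h i x)"
proof (rule sublinearI)
  have ne: "I \<noteq> {}" using zero by blast
  have low: "(INF i\<in>I. h i x) \<le> h i x" if "i \<in> I" for i x
    by (rule cINF_lower[OF bdd that])
  show "(INF i\<in>I. h i (x + y)) \<le> (INF i\<in>I. h i x) + (INF i\<in>I. h i y)" for x y
  proof -
    have pair: "(INF i\<in>I. h i (x + y)) \<le> h i x + h j y" if ij: "i \<in> I" "j \<in> I" for i j
      using add[OF ij, of x y] low order_trans by blast
    have "(INF i\<in>I. h i (x + y)) - h i x \<le> (INF j\<in>I. h j y)" if "i \<in> I" for i
      using pair[OF that] by (intro cINF_greatest[OF ne]) (simp add: diff_le_eq add.commute)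
    then have "(INF i\<in>I. h i (x + y)) - (INF j\<in>I. h j y) \<le> (INF i\<in>I. h i x)"
      by (intro cINF_greatest[OF ne]) (simp add: diff_le_eq add.commute)
    then show ?thesis by simp
  qed
  show "(INF i\<in>I. h i (c *\<^sub>R x)) \<le> c * (INF i\<in>I. h i x)" if c: "0 < c" for c x
  proof -
    have "(INF i\<in>I. h i (c *\<^sub>R x)) \<le> c * h i x" if "i \<in> I" for i
      using scale[OF c that, of x] low order_trans by blast
    then have "(INF i\<in>I. h i (c *\<^sub>R x)) / c \<le> (INF i\<in>I. h i x)"
      using c by (intro cINF_greatest[OF ne]) (auto simp: field_simps)
    then show ?thesis using c by (simp add: field_simps)
  qed
  show "(INF i\<in>I. h i 0) \<le> 0"
    using zero low order_trans by blast
qed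

text \<open>
  Zorn's lemma, applied to all sublinear functionals below \<open>p\<close>. This replaces the usual argument on
  partially defined linear functionals, because minimal sublinear functionals turn out to be linear.
\<close>

lemma minimal_sublinear_below:
  fixes p :: "'a::real_vector \<Rightarrow> real"
  assumes p: "sublinear p"
  obtains q where "sublinear q" "q \<le> p" "\<And>r. sublinear r \<Longrightarrow> r \<le> q \<Longrightarrow> r = q"
proof -
  define A where "A = {q. sublinear q \<and> q \<le> p}"
  have "\<exists>m\<in>A. \<forall>a\<in>A. a \<le> m \<longrightarrow> a = m"
  proof (rule predicate_Zorn)
    show "partial_order_on A (relation_of (\<lambda>f g. g \<le> f) A)"
      by (auto simp: partial_order_on_def preorder_on_def refl_on_def trans_def antisym_def
          relation_of_def)
  next
    fix C
    assume C: "C \<in> Chains (relation_of (\<lambda>f g. g \<le> f) A)"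
    then have CA: "f \<in> A" if "f \<in> C" for f
      using that by (auto simp: Chains_def relation_of_def)
    have tot: "f \<le> g \<or> g \<le> f" if "f \<in> C" "g \<in> C" for f g
      using C that by (auto simp: Chains_def relation_of_def)
    show "\<exists>u\<in>A. \<forall>a\<in>C. u \<le> a"
    proof (cases "C = {}")
      case True
      then show ?thesis using p by (auto simp: A_def)
    next
      case False
      then obtain f0 where f0: "f0 \<in> C" by blast
      have bdd: "bdd_below ((\<lambda>f. f x) ` C)" for x
      proof (rule bdd_belowI2)
        fix f assume "f \<in> C"
        then have "sublinear f" "f (- x) \<le> p (- x)"
          using CA by (auto simp: A_def le_fun_def)
        then show "- p (- x) \<le> f x"
          using sublinear_minus[of f x] by linarith
      qed
      have "sublinear (\<lambda>x. INF f\<in>C. f x)"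
      proof (rule sublinear_INF[OF bdd])
        fix f g x y assume fg: "f \<in> C" "g \<in> C"
        have *: "\<exists>k\<in>C. k \<le> f \<and> k \<le> g"
          using tot[OF fg] fg by blast
        then obtain k where k: "k \<in> C" "k \<le> f" "k \<le> g" by blast
        then have "k (x + y) \<le> k x + k y" "k x \<le> f x" "k y \<le> g y"
          using CA[of k] by (auto simp: A_def le_fun_def sublinear_add)
        then have "k (x + y) \<le> f x + g y" by linarith
        with k show "\<exists>k\<in>C. k (x + y) \<le> f x + g y" by blast
      next
        fix c :: real and f x assume "0 < c" "f \<in> C"
        then show "\<exists>k\<in>C. k (c *\<^sub>R x) \<le> c * f x"
          using CA[of f] by (intro bexI[of _ f]) (auto simp: A_def sublinear_scale)
      next
        show "\<exists>f\<in>C. f 0 \<le> 0"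
          using f0 CA[of f0] by (intro bexI[of _ f0]) (auto simp: A_def sublinear_zero)
      qed
      moreover have low: "(INF f\<in>C. f x) \<le> f x" if "f \<in> C" for f x
        by (rule cINF_lower[OF bdd that])
      moreover have "(\<lambda>x. INF f\<in>C. f x) \<le> p"
        using low[OF f0] CA[OF f0] order_trans by (fastforce simp: A_def le_fun_def)
      ultimately show ?thesis
        by (intro bexI[of _ "\<lambda>x. INF f\<in>C. f x"]) (auto simp: A_def le_fun_def)
    qed
  qed
  then obtain m where m: "m \<in> A" "\<And>a. a \<in> A \<Longrightarrow> a \<le> m \<Longrightarrow> a = m" by blast
  show thesis
  proof (rule that[of m])
    show "sublinear m" "m \<le> p" using m(1) by (auto simp: A_def)
    fix r assume r: "sublinear r" "r \<le> m"
    with m(1) have "r \<in> A" by (auto simp: A_def)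
    with m(2) r show "r = m" by blast
  qed
qed

text \<open>
  The functional \<open>y \<mapsto> inf (q (y + t x) - t q x)\<close>, the infimum over \<open>t \<ge> 0\<close>, is sublinear and lies
  below \<open>q\<close>, so by minimality it equals \<open>q\<close>. Its value at \<open>t = 1\<close> is then the missing inequality
  \<open>q y + q x \<le> q (y + x)\<close>.
\<close>

lemma minimal_sublinear_linear:
  fixes q :: "'a::real_vector \<Rightarrow> real"
  assumes q: "sublinear q" and min: "\<And>r. sublinear r \<Longrightarrow> r \<le> q \<Longrightarrow> r = q"
  shows "linear q"
proof -
  have add: "q (y + x) = q y + q x" for x y
  proof -
    define h where "h = (\<lambda>t y. q (y + t *\<^sub>R x) - t * q x)"
    have bdd: "bdd_below ((\<lambda>t. h t y) ` {0..})" for y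
    proof (rule bdd_belowI2)
      fix t :: real assume "t \<in> {0..}"
      then have "t * q x = q (t *\<^sub>R x)" by (simp add: q sublinear_scale)
      also have "\<dots> \<le> q (y + t *\<^sub>R x) + q (- y)"
        using sublinear_add[OF q, of "y + t *\<^sub>R x" "- y"] by simp
      finally show "- q (- y) \<le> h t y" by (simp add: h_def)
    qed
    have low: "(INF t\<in>{0..}. h t y) \<le> h t y" if "0 \<le> t" for t y
      by (rule cINF_lower[OF bdd]) (use that in simp)
    have "sublinear (\<lambda>y. INF t\<in>{0..}. h t y)"
    proof (rule sublinear_INF[OF bdd])
      fix s t y z assume "s \<in> {0::real..}" "t \<in> {0::real..}"
      then show "\<exists>k\<in>{0..}. h k (y + z) \<le> h s y + h t z"
        using sublinear_add[OF q, of "y + s *\<^sub>R x" "z + t *\<^sub>R x"]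
        by (intro bexI[of _ "s + t"]) (auto simp: h_def algebra_simps)
    next
      fix c t :: real and y assume ct: "0 < c" "t \<in> {0..}"
      then have "h (c * t) (c *\<^sub>R y) = c * h t y"
        using sublinear_scale[OF q, of c "y + t *\<^sub>R x"] by (simp add: h_def algebra_simps)
      then show "\<exists>k\<in>{0..}. h k (c *\<^sub>R y) \<le> c * h t y"
        using ct by (intro bexI[of _ "c * t"]) auto
    next
      show "\<exists>t\<in>{0..}. h t 0 \<le> 0"
        by (intro bexI[of _ 0]) (auto simp: h_def q sublinear_zero)
    qed
    moreover have "(\<lambda>y. INF t\<in>{0..}. h t y) \<le> q"
      using low[of 0] by (auto simp: le_fun_def h_def)
    ultimately have "(\<lambda>y. INF t\<in>{0..}. h t y) = q" by (rule min)
    then have "q y \<le> h 1 y" using low[of 1 y] by (metis zero_le_one)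
    then show ?thesis using sublinear_add[OF q, of y x] by (simp add: h_def)
  qed
  have neg: "q (- x) = - q x" for x
    using add[of x "- x"] by (simp add: q sublinear_zero)
  show ?thesis
  proof (rule linearI)
    show "q (c *\<^sub>R x) = c *\<^sub>R q x" for c x
    proof (cases "0 \<le> c")
      case False
      then have "q (c *\<^sub>R x) = - q ((- c) *\<^sub>R x)" by (simp add: neg)
      with False show ?thesis by (subst (asm) sublinear_scale[OF q]) auto
    qed (simp add: q sublinear_scale)
  qed (simp add: add)
qed

text \<open>
  Extension from a subspace is phrased with a linear map \<open>J\<close> into the larger space in place of an
  inclusion, so that no carrier sets are needed and \<open>J\<close> may have a kernel. The proof takes a minimal
  sublinear functional below \<open>x \<mapsto> inf (p (x - J v) + f v)\<close>: it is linear and at most \<open>f\<close> on the range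
  of \<open>J\<close>, hence equal to \<open>f\<close> there.
\<close>

theorem hahn_banach:
  fixes p :: "'b::real_vector \<Rightarrow> real" and J :: "'a::real_vector \<Rightarrow> 'b"
  assumes p: "sublinear p" and J: "linear J" and f: "linear f"
    and le: "\<And>v. f v \<le> p (J v)"
  obtains g where "linear g" "\<And>x. g x \<le> p x" "\<And>v. g (J v) = f v"
proof -
  define h where "h = (\<lambda>v x. p (x - J v) + f v)"
  have bdd: "bdd_below ((\<lambda>v. h v x) ` UNIV)" for x
  proof (rule bdd_belowI2)
    fix v
    have "- f v \<le> p (- J v)" using le[of "- v"] by (simp add: linear_neg J f)
    also have "\<dots> \<le> p (x - J v) + p (- x)"
      using sublinear_add[OF p, of "x - J v" "- x"] by simp
    finally show "- p (- x) \<le> h v x" by (simp add: h_def)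
  qed
  have low: "(INF v. h v x) \<le> h v x" for v x
    by (rule cINF_lower[OF bdd]) simp
  have "sublinear (\<lambda>x. INF v. h v x)"
  proof (rule sublinear_INF[OF bdd])
    fix v w x y
    show "\<exists>k\<in>UNIV. h k (x + y) \<le> h v x + h w y"
      using sublinear_add[OF p, of "x - J v" "y - J w"]
      by (intro bexI[of _ "v + w"]) (auto simp: h_def linear_add J f algebra_simps)
  next
    fix c :: real and v x assume c: "0 < c"
    have "h (c *\<^sub>R v) (c *\<^sub>R x) = c * h v x"
      using sublinear_scale[OF p, of c "x - J v"] c
      by (simp add: h_def linear_scale J f algebra_simps)
    then show "\<exists>k\<in>UNIV. h k (c *\<^sub>R x) \<le> c * h v x"
      by (intro bexI[of _ "c *\<^sub>R v"]) auto
  next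
    show "\<exists>v\<in>UNIV. h v 0 \<le> 0"
      by (intro bexI[of _ 0]) (auto simp: h_def linear_0 J f sublinear_zero p)
  qed
  then obtain q where q: "sublinear q" "q \<le> (\<lambda>x. INF v. h v x)"
      "\<And>r. sublinear r \<Longrightarrow> r \<le> q \<Longrightarrow> r = q"
    by (rule minimal_sublinear_below) blast
  have lin: "linear q" using q(1,3) by (rule minimal_sublinear_linear)
  have qh: "q x \<le> h v x" for v x
    using q(2) low[of x v] order_trans by (fastforce simp: le_fun_def)
  show thesis
  proof (rule that[OF lin])
    show "q x \<le> p x" for x
      using qh[of x 0] by (simp add: h_def linear_0 J f)
    have le': "q (J v) \<le> f v" for v
      using qh[of "J v" v] by (simp add: h_def sublinear_zero p)
    show "q (J v) = f v" for v
      using le'[of v] le'[of "- v"] by (simp add: linear_neg J f lin)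
  qed
qed

lemma hahn_banach_norming:
  fixes p :: "'a::real_vector \<Rightarrow> real"
  assumes p: "sublinear p"
  obtains g where "linear g" "\<And>x. g x \<le> p x" "g v = p v"
proof -
  have *: "t * p v \<le> p (t *\<^sub>R v)" for t
  proof (cases "0 \<le> t")
    case False
    then show ?thesis
      using sublinear_minus[OF p, of "t *\<^sub>R v"] sublinear_scale[OF p, of "- t" v] by simp
  qed (simp add: sublinear_scale p)
  obtain g where "linear g" "\<And>x. g x \<le> p x" "\<And>t. g (t *\<^sub>R v) = t * p v"
  proof (rule hahn_banach[OF p])
    show "linear (\<lambda>t. t *\<^sub>R v)" by (simp add: linear_iff scaleR_add_left)
    show "linear (\<lambda>t. t * p v)" by (simp add: linear_iff algebra_simps)
  qed (use * in auto)
  then show thesis using that[of g] by (metis scaleR_one mult_1)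
qed

section \<open>Finite-dimensional spaces\<close>

text \<open>
  Compactness in a space that is only known to be spanned by finitely many vectors comes from here:
  segments are compact, and sums of finitely many compact sets are compact.
\<close>

lemma compact_sum_family:
  fixes K :: "'i \<Rightarrow> 'a::real_normed_vector set"
  assumes "finite B" "\<And>b. b \<in> B \<Longrightarrow> compact (K b)"
  shows "compact {\<Sum>b\<in>B. s b | s. \<forall>b\<in>B. s b \<in> K b}"
  using assms
proof (induction B)
  case empty
  then show ?case by simp
next
  case (insert b B)
  have "{\<Sum>b\<in>insert b B. s b | s. \<forall>b\<in>insert b B. s b \<in> K b}
      = {x + y | x y. x \<in> K b \<and> y \<in> {\<Sum>b\<in>B. s b | s. \<forall>b\<in>B. s b \<in> K b}}" (is "?L = ?R")
  proof (intro equalityI subsetI)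
    fix z assume "z \<in> ?L"
    with insert.hyps show "z \<in> ?R" by auto
  next
    fix z assume "z \<in> ?R"
    then obtain x s where z: "z = x + (\<Sum>b\<in>B. s b)" "x \<in> K b" "\<forall>b\<in>B. s b \<in> K b" by blast
    have "(\<Sum>c\<in>insert b B. (s(b := x)) c) = x + (\<Sum>c\<in>B. (s(b := x)) c)"
      using insert.hyps by simp
    also have "(\<Sum>c\<in>B. (s(b := x)) c) = (\<Sum>c\<in>B. s c)"
      using insert.hyps by (intro sum.cong) auto
    finally have "z = (\<Sum>c\<in>insert b B. (s(b := x)) c)" using z by simp
    with z show "z \<in> ?L" by (intro CollectI exI[of _ "s(b := x)"]) auto
  qed
  then show ?case
    using compact_sums[of "K b" "{\<Sum>b\<in>B. s b | s. \<forall>b\<in>B. s b \<in> K b}"] insert by simp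
qed

lemma blinfun_of_bound:
  fixes f :: "'a::real_normed_vector \<Rightarrow> 'b::real_normed_vector"
  assumes "linear f" "\<And>x. norm (f x) \<le> K * norm x" "0 \<le> K"
  obtains F :: "'a \<Rightarrow>\<^sub>L 'b" where "\<And>x. blinfun_apply F x = f x" "norm F \<le> K"
proof -
  have "bounded_linear f"
    using assms by (intro bounded_linear_intro[of f K]) (auto simp: linear_add linear_scale mult.commute)
  then have *: "blinfun_apply (Blinfun f) x = f x" for x by (simp add: bounded_linear_Blinfun_apply)
  show thesis
    by (rule that[OF *]) (intro norm_blinfun_bound, auto simp: * assms)
qed

text \<open>
  Equivalence with the maximum norm of the coordinates. The combinations with all coefficients in
  \<open>[-1, 1]\<close> and at least one equal to \<open>1\<close> or \<open>-1\<close> form a compact set \<open>S\<close>. By independence \<open>S\<close> misses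
  the origin, so it keeps a distance \<open>d\<close> from it, and every nonzero combination
  is a multiple of a vector in \<open>S\<close>.
\<close>

lemma finite_independent_coord_bound:
  fixes B :: "'a::real_normed_vector set"
  assumes B: "finite B" "independent B"
  obtains d where "0 < d" "\<And>t b. b \<in> B \<Longrightarrow> d * \<bar>t b\<bar> \<le> norm (\<Sum>b\<in>B. t b *\<^sub>R b)"
proof -
  define K where "K b0 b = (\<lambda>t. t *\<^sub>R b) ` (if b = b0 then {-1, 1} else {-1..1::real})" for b0 b :: 'a
  \<comment> \<open>\<open>K b0 b\<close> holds the multiples of \<open>b\<close> that occur when \<open>b0\<close> has an extreme coefficient.\<close>
  define S where "S = (\<Union>b0\<in>B. {\<Sum>b\<in>B. s b | s. \<forall>b\<in>B. s b \<in> K b0 b})"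
  have "compact (K b0 b)" for b0 b
    unfolding K_def by (intro compact_continuous_image continuous_intros) auto
  then have "compact S"
    unfolding S_def using B(1) by (intro compact_UN compact_sum_family) auto
  moreover have "0 \<notin> S"
  proof
    assume "0 \<in> S"
    then obtain b0 s where s: "b0 \<in> B" "(\<Sum>b\<in>B. s b) = 0" "\<forall>b\<in>B. s b \<in> K b0 b"
      by (auto simp: S_def)
    have "\<exists>t. s b = t *\<^sub>R b \<and> (b = b0 \<longrightarrow> t \<noteq> 0)" if "b \<in> B" for b
    proof -
      from s(3) that obtain t where "s b = t *\<^sub>R b" "t \<in> (if b = b0 then {-1, 1} else {-1..1})"
        unfolding K_def by blast
      then show ?thesis by (intro exI[of _ t]) (auto split: if_splits)
    qed
    then obtain t where t: "\<And>b. b \<in> B \<Longrightarrow> s b = t b *\<^sub>R b \<and> (b = b0 \<longrightarrow> t b \<noteq> 0)"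
      by metis
    then have "(\<Sum>b\<in>B. t b *\<^sub>R b) = 0" using s(2) by (simp cong: sum.cong)
    with independentD[OF B(2,1) subset_refl _ s(1), of t] have "t b0 = 0" by blast
    with t s(1) show False by blast
  qed
  ultimately obtain d where d: "0 < d" "ball 0 d \<subseteq> - S"
    using openE[of "- S" 0] by (auto simp: compact_imp_closed open_Compl)
  have dS: "d \<le> norm x" if "x \<in> S" for x
  proof -
    have "x \<notin> ball 0 d" using d(2) that by blast
    then show ?thesis by simp
  qed
  show thesis
  proof (rule that[OF d(1)])
    fix t :: "'a \<Rightarrow> real" and b assume b: "b \<in> B"
    define m where "m = Max ((\<lambda>b. \<bar>t b\<bar>) ` B)"
    have mge: "\<bar>t c\<bar> \<le> m" if "c \<in> B" for c
      unfolding m_def using B(1) that by (intro Max_ge) auto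
    have "m \<in> (\<lambda>b. \<bar>t b\<bar>) ` B" unfolding m_def using B(1) b by (intro Max_in) auto
    then obtain b0 where b0: "b0 \<in> B" "\<bar>t b0\<bar> = m" by auto
    show "d * \<bar>t b\<bar> \<le> norm (\<Sum>b\<in>B. t b *\<^sub>R b)"
    proof (cases "m = 0")
      case True
      then show ?thesis using mge[OF b] by simp
    next
      case False
      with b0 have m: "0 < m" by auto
      have "(t c / m) *\<^sub>R c \<in> K b0 c" if "c \<in> B" for c
        using mge[OF that] b0 m
        by (auto simp: K_def field_simps abs_le_iff split: if_splits intro!: imageI)
           (auto simp: abs_if split: if_splits)
      then have "(\<Sum>b\<in>B. (t b / m) *\<^sub>R b) \<in> S"
        using b0 by (auto simp: S_def)
      then have "d \<le> norm (\<Sum>b\<in>B. (t b / m) *\<^sub>R b)" by (rule dS)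
      also have "(\<Sum>b\<in>B. (t b / m) *\<^sub>R b) = (1 / m) *\<^sub>R (\<Sum>b\<in>B. t b *\<^sub>R b)"
        by (simp add: scaleR_sum_right)
      finally have "d * m \<le> norm (\<Sum>b\<in>B. t b *\<^sub>R b)"
        using m by (simp add: field_simps)
      moreover have "d * \<bar>t b\<bar> \<le> d * m"
        using mge[OF b] d(1) by simp
      ultimately show ?thesis by simp
    qed
  qed
qed

lemma finite_dim_coordinates:
  assumes "finite_dim TYPE('e::real_normed_vector)"
  obtains B :: "'e::real_normed_vector set" and c :: "'e \<Rightarrow> 'e \<Rightarrow>\<^sub>L real"
  where "finite B" "\<And>x. (\<Sum>b\<in>B. c b x *\<^sub>R b) = x"
proof -
  obtain S :: "'e set" where S: "finite S" "span S = UNIV"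
    using assms by (auto simp: finite_dim_def)
  obtain B where B: "B \<subseteq> S" "independent B" "span B = span S"
    using maximal_independent_subset[of S] by (metis span_eq span_superset order_trans)
  have fin: "finite B" using B S finite_subset by blast
  obtain d where d: "0 < d" "\<And>t b. b \<in> B \<Longrightarrow> d * \<bar>t b\<bar> \<le> norm (\<Sum>b\<in>B. t b *\<^sub>R b)"
    using finite_independent_coord_bound[OF fin B(2)] by blast
  have rep: "(\<Sum>b\<in>B. representation B x b *\<^sub>R b) = x" for x
    using B S fin by (intro sum_representation_eq) auto
  have "\<exists>F :: 'e \<Rightarrow>\<^sub>L real. \<forall>x. F x = representation B x b" if "b \<in> B" for b
  proof (rule blinfun_of_bound)
    show "linear (\<lambda>x. representation B x b)"
      using B S by (intro linearI) (auto simp: representation_add representation_scale)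
    show "norm (representation B x b) \<le> inverse d * norm x" for x
      using d(2)[OF that, of "representation B x"] d(1) rep[of x] by (simp add: field_simps)
  qed (use d in auto)
  then obtain c :: "'e \<Rightarrow> 'e \<Rightarrow>\<^sub>L real" where "\<And>b x. b \<in> B \<Longrightarrow> c b x = representation B x b"
    by metis
  then show thesis by (intro that[OF fin, of c]) (simp add: rep cong: sum.cong)
qed

lemma dual_expansion:
  fixes \<xi> :: "'e::real_normed_vector \<Rightarrow>\<^sub>L real" and c :: "'e \<Rightarrow> 'e \<Rightarrow>\<^sub>L real"
  assumes "\<And>x. (\<Sum>b\<in>B. c b x *\<^sub>R b) = x"
  shows "(\<Sum>b\<in>B. \<xi> b *\<^sub>R c b) = \<xi>"
proof (rule blinfun_eqI)
  fix x
  have "\<xi> x = \<xi> (\<Sum>b\<in>B. c b x *\<^sub>R b)" by (simp add: assms)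
  then show "(\<Sum>b\<in>B. \<xi> b *\<^sub>R c b) x = \<xi> x"
    by (simp add: blinfun.scaleR_left blinfun.scaleR_right blinfun.sum_right blinfun.sum_left
        mult.commute)
qed

text \<open>
  In dual coordinates, the coefficient of \<open>\<xi>\<close> at \<open>c b\<close> is \<open>\<xi> b\<close>, which is at most \<open>norm b\<close> on the
  unit ball. So the ball is a closed subset of a compact box, and therefore totally bounded.
\<close>

lemma finite_net_dual_ball:
  assumes "finite_dim TYPE('e::real_normed_vector)" "0 < e"
  obtains X :: "('e::real_normed_vector \<Rightarrow>\<^sub>L real) set"
  where "finite X" "\<And>\<xi>. \<xi> \<in> X \<Longrightarrow> norm \<xi> \<le> 1"
    "\<And>\<xi>. norm \<xi> \<le> 1 \<Longrightarrow> \<exists>\<zeta>\<in>X. norm (\<xi> - \<zeta>) < e"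
proof -
  obtain B :: "'e set" and c :: "'e \<Rightarrow> 'e \<Rightarrow>\<^sub>L real"
    where B: "finite B" and c: "\<And>x. (\<Sum>b\<in>B. c b x *\<^sub>R b) = x"
    using finite_dim_coordinates[OF assms(1)] by blast
  define K where "K = {\<Sum>b\<in>B. s b | s. \<forall>b\<in>B. s b \<in> (\<lambda>t. t *\<^sub>R c b) ` {- norm b..norm b}}"
  have "compact K"
    unfolding K_def
    by (intro compact_sum_family B compact_continuous_image continuous_intros) auto
  moreover have "cball 0 1 \<subseteq> K"
  proof
    fix \<xi> :: "'e \<Rightarrow>\<^sub>L real" assume "\<xi> \<in> cball 0 1"
    then have 1: "norm \<xi> \<le> 1" by simp
    have "\<xi> = (\<Sum>b\<in>B. \<xi> b *\<^sub>R c b)"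
      by (simp add: dual_expansion[OF c])
    moreover have "\<bar>\<xi> b\<bar> \<le> norm b" for b
      using norm_blinfun[of \<xi> b] mult_right_mono[OF 1, of "norm b"] by simp
    then have "\<xi> b *\<^sub>R c b \<in> (\<lambda>t. t *\<^sub>R c b) ` {- norm b..norm b}" for b
      by (intro imageI) (simp add: abs_le_iff minus_le_iff)
    ultimately show "\<xi> \<in> K" unfolding K_def by blast
  qed
  ultimately have "compact (cball 0 1 :: ('e \<Rightarrow>\<^sub>L real) set)"
    using closed_Int_compact[of "cball 0 1" K] by (simp add: Int_absorb2)
  then obtain X :: "('e \<Rightarrow>\<^sub>L real) set" where X: "finite X" "X \<subseteq> cball 0 1" "cball 0 1 \<subseteq> (\<Union>x\<in>X. ball x e)"
    using seq_compact_imp_totally_bounded[of "cball 0 1 :: ('e \<Rightarrow>\<^sub>L real) set"] assms(2)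
    by (auto simp: compact_eq_seq_compact_metric)
  show thesis
  proof (rule that[OF X(1)])
    show "norm \<xi> \<le> 1" if "\<xi> \<in> X" for \<xi> using X(2) that by auto
    show "\<exists>\<zeta>\<in>X. norm (\<xi> - \<zeta>) < e" if "norm \<xi> \<le> 1" for \<xi>
    proof -
      have "\<xi> \<in> (\<Union>x\<in>X. ball x e)" using X(3) that by (intro subsetD[OF X(3)]) simp
      then show ?thesis by (auto simp: dist_norm norm_minus_commute)
    qed
  qed
qed

section \<open>The projective and injective norms\<close>

lemma tensor_linear_eqI:
  assumes "linear f" "linear g" "\<And>x y. f (x \<otimes> y) = g (x \<otimes> y)"
  shows "f u = g u"
proof (cases u rule: tensor_exhaust)
  case (formal_sum ps)
  then show ?thesis
    by (simp add: abs_tensor_eq bilin_sum_linear assms)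
qed

text \<open>
  Subadditivity carries the estimate from elementary tensors to every representation of \<open>u\<close>. Both the
  bound for pairings and the contractivity of \<open>f \<otimes> id\<close> are obtained in this way.
\<close>

lemma sublinear_le_proj_norm:
  fixes p :: "('a::real_normed_vector, 'b::real_normed_vector) tensor \<Rightarrow> real"
  assumes p: "sublinear p" and C: "0 \<le> C"
    and elem: "\<And>x y. p (x \<otimes> y) \<le> C * (norm x * norm y)"
  shows "p u \<le> C * proj_norm u"
proof -
  have *: "p (\<Sum>(x, y)\<leftarrow>ps. x \<otimes> y) \<le> C * (\<Sum>(x, y)\<leftarrow>ps. norm x * norm y)" for ps
  proof (induction ps)
    case Nil
    then show ?case by (simp add: sublinear_zero p)
  next
    case (Cons q ps)
    obtain x y where q: "q = (x, y)" by (cases q)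
    have "p (x \<otimes> y + (\<Sum>(x, y)\<leftarrow>ps. x \<otimes> y)) \<le> p (x \<otimes> y) + p (\<Sum>(x, y)\<leftarrow>ps. x \<otimes> y)"
      by (rule sublinear_add[OF p])
    with elem[of x y] Cons show ?case by (simp add: q distrib_left)
  qed
  show ?thesis
  proof (cases "C = 0")
    case True
    obtain ps where "u = abs_tensor ps" by (rule tensor_exhaust)
    with *[of ps] True show ?thesis by (simp add: abs_tensor_eq bilin_sum_def)
  next
    case False
    with C have pos: "0 < C" by simp
    have "p u / C \<le> proj_norm u"
      unfolding proj_norm_def
    proof (rule cInf_greatest[OF proj_norm_nonempty])
      fix r assume "r \<in> {(\<Sum>(x, y)\<leftarrow>ps. norm x * norm y) |ps. u = (\<Sum>(x, y)\<leftarrow>ps. x \<otimes> y)}"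
      then obtain ps where "r = (\<Sum>(x, y)\<leftarrow>ps. norm x * norm y)" "u = (\<Sum>(x, y)\<leftarrow>ps. x \<otimes> y)" by blast
      with *[of ps] pos show "p u / C \<le> r" by (simp add: field_simps)
    qed
    with pos show ?thesis by (simp add: field_simps)
  qed
qed

lemma proj_norm_le:
  "proj_norm (\<Sum>(x, y)\<leftarrow>ps. x \<otimes> y) \<le> (\<Sum>(x, y)\<leftarrow>ps. norm x * norm y)"
  unfolding proj_norm_def by (rule cInf_lower[OF _ proj_norm_bdd_below]) blast

lemma proj_norm_elem: "proj_norm (x \<otimes> y) \<le> norm x * norm y"
  using proj_norm_le[of "[(x, y)]"] by simp

lemma proj_norm_approx:
  assumes "0 < e"
  obtains ps where "u = (\<Sum>(x, y)\<leftarrow>ps. x \<otimes> y)" "(\<Sum>(x, y)\<leftarrow>ps. norm x * norm y) < proj_norm u + e"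
proof -
  have "Inf {(\<Sum>(x, y)\<leftarrow>ps. norm x * norm y) |ps. u = (\<Sum>(x, y)\<leftarrow>ps. x \<otimes> y)} < proj_norm u + e"
    using assms by (simp add: proj_norm_def)
  from cInf_lessD[OF proj_norm_nonempty this] that show thesis by blast
qed

lemma sublinear_proj_norm: "sublinear proj_norm"
proof (rule sublinearI)
  fix u v :: "('a, 'b) tensor"
  show "proj_norm (u + v) \<le> proj_norm u + proj_norm v"
  proof (rule field_le_epsilon)
    fix e :: real assume "0 < e"
    then have "0 < e / 2" by simp
    from proj_norm_approx[OF this, of u] obtain ps where
      ps: "u = (\<Sum>(x, y)\<leftarrow>ps. x \<otimes> y)" "(\<Sum>(x, y)\<leftarrow>ps. norm x * norm y) < proj_norm u + e / 2" .
    from proj_norm_approx[OF \<open>0 < e / 2\<close>, of v] obtain qs where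
      qs: "v = (\<Sum>(x, y)\<leftarrow>qs. x \<otimes> y)" "(\<Sum>(x, y)\<leftarrow>qs. norm x * norm y) < proj_norm v + e / 2" .
    show "proj_norm (u + v) \<le> proj_norm u + proj_norm v + e"
      using proj_norm_le[of "ps @ qs"] ps qs by simp
  qed
next
  fix c :: real and u :: "('a, 'b) tensor" assume c: "0 < c"
  show "proj_norm (c *\<^sub>R u) \<le> c * proj_norm u"
  proof (rule field_le_epsilon)
    fix e :: real assume "0 < e"
    with c have "0 < e / c" by simp
    from proj_norm_approx[OF this, of u] obtain ps where
      ps: "u = (\<Sum>(x, y)\<leftarrow>ps. x \<otimes> y)" "(\<Sum>(x, y)\<leftarrow>ps. norm x * norm y) < proj_norm u + e / c" .
    have "c *\<^sub>R (\<Sum>(x, y)\<leftarrow>ps. x \<otimes> y) = (\<Sum>(x, y)\<leftarrow>map (map_prod ((*\<^sub>R) c) id) ps. x \<otimes> y)"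
      by (induction ps)
        (auto simp: scaleR_add_right bilinear_lmul[OF bilinear_tensor_elem])
    moreover have "(\<Sum>(x, y)\<leftarrow>map (map_prod ((*\<^sub>R) c) id) ps. norm x * norm y)
        = c * (\<Sum>(x, y)\<leftarrow>ps. norm x * norm y)"
      using c by (induction ps) (auto simp: distrib_left)
    ultimately have "proj_norm (c *\<^sub>R u) \<le> c * (\<Sum>(x, y)\<leftarrow>ps. norm x * norm y)"
      using proj_norm_le[of "map (map_prod ((*\<^sub>R) c) id) ps"] ps by simp
    also have "\<dots> \<le> c * (proj_norm u + e / c)"
      using c ps(2) by (intro mult_left_mono) auto
    finally show "proj_norm (c *\<^sub>R u) \<le> c * proj_norm u + e"
      using c by (simp add: distrib_left)
  qed
next
  show "proj_norm (0 :: ('a, 'b) tensor) \<le> 0"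
    using proj_norm_le[of "[]"] by simp
qed

lemma proj_norm_nonneg: "0 \<le> proj_norm u"
  unfolding proj_norm_def by (rule cInf_greatest[OF proj_norm_nonempty]) (auto intro!: sum_list_nonneg)

lemma proj_norm_tensor_map_le:
  assumes f: "linear f" "\<And>x. norm (f x) \<le> norm x"
  shows "proj_norm (tensor_map f id u) \<le> proj_norm u"
proof -
  have lin: "linear (tensor_map f id)"
    using f(1) by (rule linear_tensor_map) (simp add: id_def linear_iff)
  have "proj_norm (tensor_map f id u) \<le> 1 * proj_norm u"
  proof (rule sublinear_le_proj_norm)
    show "sublinear (\<lambda>u. proj_norm (tensor_map f id u))"
      using sublinear_proj_norm
      by (auto simp: sublinear_def linear_add[OF lin] linear_scale[OF lin])
    show "proj_norm (tensor_map f id (x \<otimes> y)) \<le> 1 * (norm x * norm y)" for x and y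
    proof -
      have "tensor_map f id (x \<otimes> y) = f x \<otimes> y"
        using f(1) by (subst tensor_map_elem) (auto simp: id_def linear_iff)
      moreover have "norm (f x) * norm y \<le> norm x * norm y"
        by (intro mult_right_mono f) simp
      ultimately show ?thesis using proj_norm_elem[of "f x" y] by simp
    qed
  qed simp
  then show ?thesis by simp
qed

definition tensor_form ::
  "('a::real_normed_vector \<Rightarrow>\<^sub>L real) \<Rightarrow> ('b::real_normed_vector \<Rightarrow>\<^sub>L real) \<Rightarrow> ('a, 'b) tensor \<Rightarrow> real" where
  "tensor_form \<xi> \<eta> = tensor_lift (\<lambda>x y. \<xi> x * \<eta> y)"

lemma linear_tensor_form: "linear (tensor_form \<xi> \<eta>)"
  unfolding tensor_form_def by (rule linear_tensor_lift[OF bilinear_blinfun_mult])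

lemma tensor_form_elem [simp]: "tensor_form \<xi> \<eta> (x \<otimes> y) = \<xi> x * \<eta> y"
  by (simp add: tensor_form_def bilinear_blinfun_mult)

lemma bilinear_tensor_form: "bilinear (\<lambda>\<xi> \<eta>. tensor_form \<xi> \<eta> w)"
proof (cases w rule: tensor_exhaust)
  case (formal_sum ps)
  have "bilinear (\<lambda>\<xi> \<eta>. bilin_sum (\<lambda>x y. blinfun_apply \<xi> x * (blinfun_apply \<eta> y :: real)) ps)"
    by (induction ps)
      (auto simp: bilinear_def linear_iff blinfun.add_left blinfun.scaleR_left algebra_simps)
  then show ?thesis
    by (simp add: formal_sum tensor_form_def tensor_lift_abs bilinear_blinfun_mult)
qed

lemma inj_norm_upper:
  assumes "norm \<xi> \<le> 1" "norm \<eta> \<le> 1"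
  shows "\<bar>tensor_form \<xi> \<eta> u\<bar> \<le> inj_norm u"
  unfolding inj_norm_def tensor_form_def
  using cSUP_upper[OF _ inj_norm_bdd_above[of u], of "(\<xi>, \<eta>)"] assms by simp

lemma inj_norm_least:
  assumes "\<And>\<xi> \<eta>. norm \<xi> \<le> 1 \<Longrightarrow> norm \<eta> \<le> 1 \<Longrightarrow> \<bar>tensor_form \<xi> \<eta> u\<bar> \<le> C"
  shows "inj_norm u \<le> C"
  unfolding inj_norm_def
proof (rule cSUP_least)
  have "norm (0 :: 'a \<Rightarrow>\<^sub>L real) \<le> 1" "norm (0 :: 'b \<Rightarrow>\<^sub>L real) \<le> 1" by simp_all
  then show "{\<xi> :: 'a \<Rightarrow>\<^sub>L real. norm \<xi> \<le> 1} \<times> {\<eta> :: 'b \<Rightarrow>\<^sub>L real. norm \<eta> \<le> 1} \<noteq> {}" by blast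
qed (use assms in \<open>auto simp: tensor_form_def\<close>)

lemma inj_norm_nonneg: "0 \<le> inj_norm u"
  using inj_norm_upper[of 0 0 u] by (simp add: order_trans[OF abs_ge_zero])

lemma inj_norm_scale: "inj_norm (c *\<^sub>R u) \<le> \<bar>c\<bar> * inj_norm u"
  by (rule inj_norm_least)
    (simp add: linear_scale[OF linear_tensor_form] abs_mult mult_left_mono inj_norm_upper)

lemma tensor_form_bound: "\<bar>tensor_form \<xi> \<eta> u\<bar> \<le> norm \<xi> * norm \<eta> * inj_norm u"
proof -
  have *: "norm (sgn \<zeta>) \<le> 1" for \<zeta> :: "'c::real_normed_vector" by (simp add: norm_sgn)
  have s: "\<zeta> = norm \<zeta> *\<^sub>R sgn \<zeta>" for \<zeta> :: "'c::real_normed_vector" by (cases "\<zeta> = 0") (auto simp: sgn_div_norm)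
  have "tensor_form \<xi> \<eta> u = tensor_form (norm \<xi> *\<^sub>R sgn \<xi>) (norm \<eta> *\<^sub>R sgn \<eta>) u"
    using s[of \<xi>] s[of \<eta>] by metis
  also have "\<dots> = norm \<xi> * norm \<eta> * tensor_form (sgn \<xi>) (sgn \<eta>) u"
    by (simp add: bilinear_lmul[OF bilinear_tensor_form] bilinear_rmul[OF bilinear_tensor_form])
  also have "\<bar>\<dots>\<bar> \<le> norm \<xi> * norm \<eta> * inj_norm u"
    by (simp add: abs_mult mult_left_mono inj_norm_upper *)
  finally show ?thesis .
qed

section \<open>Pairings of tensor products\<close>

definition bilin_transpose ::
  "('a::real_normed_vector \<Rightarrow>\<^sub>L 'b::real_normed_vector \<Rightarrow>\<^sub>L real) \<Rightarrow> 'b \<Rightarrow>\<^sub>L 'a \<Rightarrow>\<^sub>L real" where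
  "bilin_transpose A = Blinfun (\<lambda>y. Blinfun (\<lambda>x. A x y))"

lemma bilin_transpose_apply [simp]: "bilin_transpose A y x = A x y"
  and norm_bilin_transpose: "norm (bilin_transpose A) \<le> norm A"
proof -
  have bound: "norm (A x y) \<le> norm A * norm x * norm y" for x y
    using norm_blinfun[of "A x" y] norm_blinfun[of A x]
    by (meson mult_right_mono norm_ge_zero order_trans)
  have inner: "bounded_linear (\<lambda>x. A x y)" for y
    by (rule bounded_linear_intro[of _ "norm A * norm y"])
      (use bound in \<open>auto simp: blinfun.add_left blinfun.scaleR_left blinfun.add_right blinfun.scaleR_right mult_ac\<close>)
  define f where "f y = Blinfun (\<lambda>x. A x y)" for y
  have f: "f y x = A x y" for x y
    by (simp add: f_def bounded_linear_Blinfun_apply inner)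
  have nf: "norm (f y) \<le> norm A * norm y" for y
    by (rule norm_blinfun_bound) (use bound in \<open>auto simp: f mult_ac\<close>)
  have "bounded_linear f"
    by (rule bounded_linear_intro[of _ "norm A"])
      (use nf in \<open>auto intro!: blinfun_eqI simp: f blinfun.add_left blinfun.scaleR_left
        blinfun.add_right blinfun.scaleR_right mult_ac\<close>)
  then have ap: "bilin_transpose A y = f y" for y
    unfolding bilin_transpose_def f_def[symmetric] by (simp add: bounded_linear_Blinfun_apply)
  show "bilin_transpose A y x = A x y" by (simp add: ap f)
  show "norm (bilin_transpose A) \<le> norm A"
    by (rule norm_blinfun_bound) (auto simp: ap nf)
qed

text \<open>
  The forms \<open>j\<close> and \<open>k\<close> vary because three kinds of pairing occur: \<open>id_blinfun\<close> is evaluation of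
  a functional at a vector, its transpose is evaluation of a vector at a functional, and a general
  \<open>A\<close> in the first place is the pairing twisted by an operator \<open>E \<Rightarrow> E*\<close>.
\<close>

definition tensor_pair ::
  "('a::real_normed_vector \<Rightarrow>\<^sub>L 'c::real_normed_vector \<Rightarrow>\<^sub>L real) \<Rightarrow>
    ('b::real_normed_vector \<Rightarrow>\<^sub>L 'd::real_normed_vector \<Rightarrow>\<^sub>L real) \<Rightarrow>
    ('a, 'b) tensor \<Rightarrow> ('c, 'd) tensor \<Rightarrow> real" where
  "tensor_pair j k v w = tensor_lift (\<lambda>a b. tensor_form (j a) (k b) w) v"

lemma bilinear_tensor_pair_form: "bilinear (\<lambda>a b. tensor_form (blinfun_apply j a) (blinfun_apply k b) w)"
  by (rule bilinear_compose[OF bilinear_tensor_form])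
    (auto intro: bounded_linear.linear blinfun.bounded_linear_right)

lemma linear_tensor_pair: "linear (\<lambda>v. tensor_pair j k v w)"
  using linear_tensor_lift[OF bilinear_tensor_pair_form[of j k w]] by (simp add: tensor_pair_def eta_contract_eq)

lemma tensor_pair_elem [simp]: "tensor_pair j k (a \<otimes> b) w = tensor_form (j a) (k b) w"
  by (simp add: tensor_pair_def bilinear_tensor_pair_form)

lemma tensor_pair_transpose:
  "tensor_pair (bilin_transpose j) (bilin_transpose k) w v = tensor_pair j k v w"
proof (rule tensor_linear_eqI[OF linear_tensor_pair])
  show "linear (tensor_pair j k v)"
  proof (rule linearI)
    show "tensor_pair j k v (x + y) = tensor_pair j k v x + tensor_pair j k v y" for x y
      by (rule tensor_linear_eqI[OF linear_tensor_pair
            linear_compose_add[OF linear_tensor_pair linear_tensor_pair]])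
        (simp add: linear_add[OF linear_tensor_form])
    show "tensor_pair j k v (c *\<^sub>R x) = c *\<^sub>R tensor_pair j k v x" for c x
      by (rule tensor_linear_eqI[OF linear_tensor_pair
            linear_compose_scale_right[OF linear_tensor_pair]])
        (simp add: linear_scale[OF linear_tensor_form])
  qed
  show "tensor_pair (bilin_transpose j) (bilin_transpose k) (c \<otimes> d) v = tensor_pair j k v (c \<otimes> d)" for c d
    by (simp, rule tensor_linear_eqI[OF linear_tensor_form linear_tensor_pair]) simp
qed

lemma tensor_pair_map:
  fixes k :: "'b::real_normed_vector \<Rightarrow>\<^sub>L 'd::real_normed_vector \<Rightarrow>\<^sub>L real"
  shows "tensor_pair id_blinfun k (tensor_map (blinfun_apply A) id u) w = tensor_pair A k u w"
proof -
  have lin: "linear (blinfun_apply A)" "linear (id :: 'b \<Rightarrow> 'b)"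
    by (auto simp: linear_iff blinfun.add_right blinfun.scaleR_right)
  show ?thesis
  proof (rule tensor_linear_eqI[of "\<lambda>u. tensor_pair id_blinfun k (tensor_map (blinfun_apply A) id u) w"])
    show "linear (\<lambda>u. tensor_pair id_blinfun k (tensor_map (blinfun_apply A) id u) w)"
      using linear_compose[OF linear_tensor_map[OF lin] linear_tensor_pair] by (simp add: o_def)
  qed (simp_all add: lin linear_tensor_pair)
qed

lemma tensor_pair_bound:
  assumes "norm j \<le> 1" "norm k \<le> 1"
  shows "\<bar>tensor_pair j k v w\<bar> \<le> inj_norm w * proj_norm v"
proof (rule sublinear_le_proj_norm)
  show "sublinear (\<lambda>v. \<bar>tensor_pair j k v w\<bar>)"
    by (auto simp: sublinear_def linear_add[OF linear_tensor_pair] linear_scale[OF linear_tensor_pair] abs_mult)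
  show "0 \<le> inj_norm w" by (rule inj_norm_nonneg)
  show "\<bar>tensor_pair j k (a \<otimes> b) w\<bar> \<le> inj_norm w * (norm a * norm b)" for a b
  proof -
    have "norm (j a) \<le> norm a" "norm (k b) \<le> norm b"
      using assms norm_blinfun[of j a] norm_blinfun[of k b]
      by (meson mult_left_le_one_le norm_ge_zero order_trans)+
    then have "norm (j a) * norm (k b) * inj_norm w \<le> norm a * norm b * inj_norm w"
      by (intro mult_right_mono mult_mono inj_norm_nonneg) auto
    with tensor_form_bound[of "j a" "k b" w] show ?thesis by (simp add: mult.commute)
  qed
qed

section \<open>Functionals on finite sequences\<close>

text \<open>
  Otherwise \<open>norm \<eta> - e\<close> would be a bound for \<open>\<eta>\<close> on the unit ball, hence at least its own norm.
\<close>

lemma near_norming: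
  fixes \<eta> :: "'a::real_normed_vector \<Rightarrow>\<^sub>L real"
  assumes "0 < e"
  obtains y where "norm y \<le> 1" "norm \<eta> - e \<le> \<eta> y"
proof (rule ccontr)
  assume "\<not> thesis"
  with that have *: "\<eta> y < norm \<eta> - e" if "norm y \<le> 1" for y
    using that not_le by blast
  have pos: "0 < norm \<eta> - e" using *[of 0] by simp
  have up: "\<eta> x \<le> (norm \<eta> - e) * norm x" for x
  proof -
    have "norm (sgn x) \<le> 1" by (simp add: norm_sgn)
    then have "\<eta> (sgn x) \<le> norm \<eta> - e" by (rule less_imp_le[OF *])
    then have "norm x * \<eta> (sgn x) \<le> norm x * (norm \<eta> - e)" by (rule mult_left_mono) simp
    moreover have "norm x * \<eta> (sgn x) = \<eta> x"
      by (cases "x = 0") (simp_all add: sgn_div_norm blinfun.scaleR_right blinfun.zero_right)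
    ultimately show ?thesis by (simp add: mult.commute)
  qed
  have "norm \<eta> \<le> norm \<eta> - e"
  proof (rule norm_blinfun_bound)
    show "norm (\<eta> x) \<le> (norm \<eta> - e) * norm x" for x
      using up[of x] up[of "- x"] by (simp add: blinfun.minus_right)
  qed (use pos in simp)
  with assms show False by simp
qed

text \<open>
  Sequences in \<open>F\<close> of length \<open>n\<close> with the supremum norm, realised inside the bounded functions on
  the discrete space of natural numbers. In this way \<open>n\<close> may depend on the net chosen in a proof.
\<close>

definition cutoff :: "nat \<Rightarrow> (nat \<Rightarrow> 'f::real_normed_vector) \<Rightarrow> nat \<Rightarrow>\<^sub>C 'f" where
  "cutoff n f = Bcontfun (\<lambda>i. if i < n then f i else 0)"

lemma cutoff_apply [simp]: "cutoff n f i = (if i < n then f i else 0)"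
proof -
  have "range (\<lambda>i. if i < n then f i else 0) \<subseteq> insert 0 (f ` {..<n})" by auto
  then have "bounded (range (\<lambda>i. if i < n then f i else 0))"
    by (rule bounded_subset[rotated]) (simp add: finite_imp_bounded)
  then have "(\<lambda>i. if i < n then f i else 0) \<in> bcontfun"
    by (simp add: bcontfun_def)
  then show ?thesis by (simp add: cutoff_def Bcontfun_inverse)
qed

text \<open>
  The dual of sequences with the supremum norm is sequences of functionals with the sum of the
  norms. A sequence of vectors of norm at most 1, each nearly norming for its \<open>\<eta> i\<close>, is mapped by \<open>g\<close>
  nearly to the sum of the norms, and its image is at most \<open>C\<close>.
\<close>

lemma functional_on_finite_sequences:
  fixes g :: "(nat \<Rightarrow>\<^sub>C 'f::real_normed_vector) \<Rightarrow> real"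
  assumes g: "linear g" "\<And>z. g z \<le> C * norm z" and C: "0 \<le> C"
  obtains \<eta> :: "nat \<Rightarrow> 'f \<Rightarrow>\<^sub>L real"
  where "\<And>f. g (cutoff n f) = (\<Sum>i<n. \<eta> i (f i))" "(\<Sum>i<n. norm (\<eta> i)) \<le> C"
proof -
  have gb: "norm (g z) \<le> C * norm z" for z
    using g(2)[of z] g(2)[of "- z"] by (simp add: linear_neg[OF g(1)])
  define s :: "nat \<Rightarrow> 'f \<Rightarrow> nat \<Rightarrow>\<^sub>C 'f" where "s i y = cutoff n (\<lambda>k. if k = i then y else 0)" for i y
  have s_lin: "linear (s i)" for i
    by (rule linearI; rule bcontfun_eqI) (simp_all add: s_def)
  have s_norm: "norm (s i y) \<le> norm y" for i y
    by (rule norm_bound) (simp add: s_def)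
  have "\<exists>F :: 'f \<Rightarrow>\<^sub>L real. \<forall>y. F y = g (s i y)" for i
  proof (rule blinfun_of_bound[of "\<lambda>y. g (s i y)" C])
    show "linear (\<lambda>y. g (s i y))" using linear_compose[OF s_lin g(1)] by (simp add: o_def)
    show "norm (g (s i y)) \<le> C * norm y" for y
      using gb[of "s i y"] mult_left_mono[OF s_norm C] order_trans by blast
  qed (use C in auto)
  then obtain \<eta> :: "nat \<Rightarrow> 'f \<Rightarrow>\<^sub>L real" where \<eta>: "\<And>i y. \<eta> i y = g (s i y)" by metis
  have sum_apply: "apply_bcontfun (sum F A) k = (\<Sum>i\<in>A. F i k)" for F :: "nat \<Rightarrow> nat \<Rightarrow>\<^sub>C 'f" and A k
    by (induction A rule: infinite_finite_induct) auto
  have expand: "g (cutoff n f) = (\<Sum>i<n. \<eta> i (f i))" for f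
  proof -
    have "cutoff n f = (\<Sum>i<n. s i (f i))"
      by (rule bcontfun_eqI) (simp add: sum_apply s_def)
    then show ?thesis by (simp add: linear_sum[OF g(1)] \<eta>)
  qed
  have "(\<Sum>i<n. norm (\<eta> i)) \<le> C"
  proof (rule field_le_epsilon)
    fix e :: real assume e: "0 < e"
    \<comment> \<open>The errors of the \<open>n\<close> nearly norming vectors must add up to at most \<open>e\<close>, also for \<open>n = 0\<close>.\<close>
    define d where "d = e / (n + 1)"
    have d: "0 < d" "n * d \<le> e" using e by (simp_all add: d_def field_simps)
    have "\<exists>y. norm y \<le> 1 \<and> norm (\<eta> i) - d \<le> \<eta> i y" for i
      using near_norming[OF d(1)] by metis
    then obtain y where y: "\<And>i. norm (y i) \<le> 1" "\<And>i. norm (\<eta> i) - d \<le> \<eta> i (y i)" by metis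
    have "(\<Sum>i<n. norm (\<eta> i) - d) \<le> (\<Sum>i<n. \<eta> i (y i))" by (intro sum_mono y)
    also have "\<dots> = g (cutoff n y)" by (simp add: expand)
    also have "\<dots> \<le> C * norm (cutoff n y)" by (rule g)
    also have "\<dots> \<le> C * 1"
      using y(1) by (intro mult_left_mono C norm_bound) simp
    finally show "(\<Sum>i<n. norm (\<eta> i)) \<le> C + e"
      using d(2) by (simp add: sum_subtractf)
  qed
  with expand that show thesis by blast
qed

section \<open>Duality of the injective and projective norms\<close>

text \<open>
  Hahn-Banach gives a functional \<open>g\<close> below the projective norm that attains it at \<open>v\<close>. The bilinear
  form \<open>(\<xi>, y) \<mapsto> g (\<xi> \<otimes> y)\<close> is a map \<open>G\<close> from \<open>E*\<close> to \<open>F*\<close> of norm at most 1, and for \<open>E\<close> of finite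
  dimension such a map is a tensor, namely the sum of the \<open>b \<otimes> G (c b)\<close>.
\<close>

lemma proj_norm_attained_by_pairing:
  fixes v :: "('e::real_normed_vector \<Rightarrow>\<^sub>L real, 'f::real_normed_vector) tensor"
  assumes "finite_dim TYPE('e)"
  obtains u :: "('e, 'f \<Rightarrow>\<^sub>L real) tensor"
  where "inj_norm u \<le> 1" "tensor_pair id_blinfun (bilin_transpose id_blinfun) v u = proj_norm v"
proof -
  obtain B :: "'e set" and c :: "'e \<Rightarrow> 'e \<Rightarrow>\<^sub>L real"
    where B: "finite B" and c: "\<And>x. (\<Sum>b\<in>B. c b x *\<^sub>R b) = x"
    using finite_dim_coordinates[OF assms] by blast
  obtain g :: "('e \<Rightarrow>\<^sub>L real, 'f) tensor \<Rightarrow> real"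
    where g: "linear g" "\<And>w. g w \<le> proj_norm w" "g v = proj_norm v"
    using hahn_banach_norming[OF sublinear_proj_norm] by blast
  have gb: "bilinear (\<lambda>\<xi> y. g (\<xi> \<otimes> y))"
    using bilinear_tensor_elem[where 'a="'e \<Rightarrow>\<^sub>L real" and 'b='f] g(1)
    unfolding bilinear_def linear_iff by simp
  have bound: "norm (g (\<xi> \<otimes> y)) \<le> norm \<xi> * norm y" for \<xi> y
  proof -
    have "g (\<xi> \<otimes> y) \<le> norm \<xi> * norm y" for \<xi> y
      using g(2) proj_norm_elem order_trans by blast
    from this[of \<xi> y] this[of "- \<xi>" y] show ?thesis
      by (simp add: bilinear_lneg[OF gb])
  qed
  have "\<exists>G :: 'f \<Rightarrow>\<^sub>L real. (\<forall>y. blinfun_apply G y = g (\<xi> \<otimes> y)) \<and> norm G \<le> norm \<xi>" for \<xi>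
    by (rule blinfun_of_bound[of "\<lambda>y. g (\<xi> \<otimes> y)" "norm \<xi>"])
      (use gb bound in \<open>auto simp: bilinear_def\<close>)
  then obtain G :: "('e \<Rightarrow>\<^sub>L real) \<Rightarrow> 'f \<Rightarrow>\<^sub>L real"
    where G: "\<And>\<xi> y. blinfun_apply (G \<xi>) y = g (\<xi> \<otimes> y)" "\<And>\<xi>. norm (G \<xi>) \<le> norm \<xi>"
    by metis
  have linG: "linear G"
    by (rule linearI; rule blinfun_eqI)
      (simp_all add: G blinfun.add_left blinfun.scaleR_left bilinear_ladd[OF gb] bilinear_lmul[OF gb])
  define u where "u = (\<Sum>b\<in>B. b \<otimes> G (c b))"
  have form: "tensor_form \<xi> \<eta> u = \<eta> (G \<xi>)" for \<xi> \<eta>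
  proof -
    have "tensor_form \<xi> \<eta> u = (\<Sum>b\<in>B. \<xi> b * \<eta> (G (c b)))"
      by (simp add: u_def linear_sum[OF linear_tensor_form])
    also have "\<dots> = \<eta> (G (\<Sum>b\<in>B. \<xi> b *\<^sub>R c b))"
      by (simp add: linear_sum[OF linG] linear_scale[OF linG] blinfun.sum_right blinfun.scaleR_right)
    finally show ?thesis by (simp only: dual_expansion[OF c])
  qed
  show thesis
  proof (rule that[of u])
    show "inj_norm u \<le> 1"
    proof (rule inj_norm_least)
      fix \<xi> :: "'e \<Rightarrow>\<^sub>L real" and \<eta> :: "('f \<Rightarrow>\<^sub>L real) \<Rightarrow>\<^sub>L real"
      assume "norm \<xi> \<le> 1" "norm \<eta> \<le> 1"
      then have "norm \<eta> * norm (G \<xi>) \<le> 1 * 1"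
        using G(2)[of \<xi>] by (intro mult_mono) auto
      then show "\<bar>tensor_form \<xi> \<eta> u\<bar> \<le> 1"
        using norm_blinfun[of \<eta> "G \<xi>"] by (simp add: form)
    qed
    have "tensor_pair id_blinfun (bilin_transpose id_blinfun) v u = g v"
      by (rule tensor_linear_eqI[OF linear_tensor_pair g(1)]) (simp add: form G)
    with g(3) show "tensor_pair id_blinfun (bilin_transpose id_blinfun) v u = proj_norm v" by simp
  qed
qed

text \<open>
  Pairing \<open>z\<close> with \<open>b \<otimes> y\<close> reads off the coefficient \<open>D b z\<close> of \<open>z\<close> at the basis functional \<open>c b\<close>, and
  the coefficients determine \<open>z\<close>.
\<close>

lemma tensor_pair_separates:
  fixes v v' :: "('e::real_normed_vector \<Rightarrow>\<^sub>L real, 'f::real_normed_vector \<Rightarrow>\<^sub>L real) tensor"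
  assumes "finite_dim TYPE('e)"
    and eq: "\<And>w. tensor_pair id_blinfun id_blinfun v w = tensor_pair id_blinfun id_blinfun v' w"
  shows "v = v'"
proof -
  obtain B :: "'e set" and c :: "'e \<Rightarrow> 'e \<Rightarrow>\<^sub>L real"
    where B: "finite B" and c: "\<And>x. (\<Sum>b\<in>B. c b x *\<^sub>R b) = x"
    using finite_dim_coordinates[OF assms(1)] by blast
  define D :: "'e \<Rightarrow> ('e \<Rightarrow>\<^sub>L real, 'f \<Rightarrow>\<^sub>L real) tensor \<Rightarrow> 'f \<Rightarrow>\<^sub>L real"
    where "D b = tensor_lift (\<lambda>\<xi> g. blinfun_apply \<xi> b *\<^sub>R g)" for b
  have bil: "bilinear (\<lambda>(\<xi> :: 'e \<Rightarrow>\<^sub>L real) (g :: 'f \<Rightarrow>\<^sub>L real). \<xi> b *\<^sub>R g)" for b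
    by (auto simp: bilinear_def linear_iff blinfun.add_left blinfun.scaleR_left algebra_simps)
  have linD: "linear (D b)" for b unfolding D_def by (rule linear_tensor_lift[OF bil])
  have D_elem: "D b (\<xi> \<otimes> g) = \<xi> b *\<^sub>R g" for b \<xi> g by (simp add: D_def bil)
  have Dpair: "D b z y = tensor_pair id_blinfun id_blinfun z (b \<otimes> y)" for b z y
    by (rule tensor_linear_eqI[of "\<lambda>z. D b z y"])
      (simp_all add: linear_tensor_pair D_elem blinfun.add_left blinfun.scaleR_left
        linearI linear_add[OF linD] linear_scale[OF linD])
  have "D b v = D b v'" for b
    by (rule blinfun_eqI) (simp add: Dpair eq)
  moreover have expand: "(\<Sum>b\<in>B. c b \<otimes> D b z) = z" for z
  proof (rule tensor_linear_eqI[of "\<lambda>z. \<Sum>b\<in>B. c b \<otimes> D b z" "\<lambda>z. z"])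
    show "linear (\<lambda>z. \<Sum>b\<in>B. c b \<otimes> D b z)"
      by (rule linearI) (simp_all add: linear_add[OF linD] linear_scale[OF linD] sum.distrib
          scaleR_sum_right bilinear_radd[OF bilinear_tensor_elem] bilinear_rmul[OF bilinear_tensor_elem])
    show "linear (\<lambda>z :: ('e \<Rightarrow>\<^sub>L real, 'f \<Rightarrow>\<^sub>L real) tensor. z)" by (simp add: linear_iff)
    show "(\<Sum>b\<in>B. c b \<otimes> D b (\<xi> \<otimes> g)) = \<xi> \<otimes> g" for \<xi> g
    proof -
      have "(\<Sum>b\<in>B. c b \<otimes> D b (\<xi> \<otimes> g)) = (\<Sum>b\<in>B. (\<xi> b *\<^sub>R c b) \<otimes> g)"
        by (simp add: D_elem bilinear_lmul[OF bilinear_tensor_elem] bilinear_rmul[OF bilinear_tensor_elem])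
      also have "\<dots> = (\<Sum>b\<in>B. \<xi> b *\<^sub>R c b) \<otimes> g"
        by (intro linear_sum[of "\<lambda>z. z \<otimes> g", symmetric])
          (simp add: bilinear_tensor_elem[unfolded bilinear_def])
      finally show ?thesis by (simp only: dual_expansion[OF c])
    qed
  qed
  ultimately show ?thesis by (metis (no_types, lifting) sum.cong)
qed

definition contract :: "('a::real_normed_vector \<Rightarrow>\<^sub>L real) \<Rightarrow> ('a, 'b::real_normed_vector) tensor \<Rightarrow> 'b" where
  "contract \<xi> = tensor_lift (\<lambda>x y. \<xi> x *\<^sub>R y)"

lemma contract_bilinear: "bilinear (\<lambda>x y. blinfun_apply (\<xi> :: 'a::real_normed_vector \<Rightarrow>\<^sub>L real) x *\<^sub>R (y :: 'b::real_normed_vector))"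
  by (auto simp: bilinear_def linear_iff blinfun.add_right blinfun.scaleR_right algebra_simps)

lemma linear_contract: "linear (contract \<xi>)"
  unfolding contract_def by (rule linear_tensor_lift[OF contract_bilinear])

lemma contract_elem: "contract \<xi> (x \<otimes> y) = \<xi> x *\<^sub>R y"
  by (simp add: contract_def contract_bilinear)

lemma blinfun_contract: "blinfun_apply \<eta> (contract \<xi> w) = tensor_form \<xi> \<eta> w"
  by (rule tensor_linear_eqI[of "\<lambda>w. \<eta> (contract \<xi> w)"])
    (simp_all add: linear_tensor_form contract_elem blinfun.scaleR_right blinfun.add_right linearI
      linear_add[OF linear_contract] linear_scale[OF linear_contract])

text \<open>
  The functional \<open>w \<mapsto> \<langle>v, w\<rangle>\<close> on \<open>E \<otimes> F\<close> is bounded by \<open>c\<close> times the injective norm. For a net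
  \<open>h 0, \<dots>, h (n - 1)\<close> of the dual ball with mesh \<open>e\<close>, the injective norm of \<open>w\<close> is at most
  \<open>1 / (1 - e)\<close> times the largest norm of the vectors \<open>contract (h i) w\<close> of \<open>F\<close>. So the functional
  extends to sequences in \<open>F\<close> with bound \<open>c / (1 - e)\<close>, and splitting the extension into its
  components \<open>\<eta> i\<close> exhibits \<open>v\<close> as the sum of the \<open>h i \<otimes> \<eta> i\<close>. Finally \<open>e\<close> tends to 0.
\<close>

lemma proj_norm_le_of_pairing:
  fixes v :: "('e::real_normed_vector \<Rightarrow>\<^sub>L real, 'f::real_normed_vector \<Rightarrow>\<^sub>L real) tensor"
  assumes fin: "finite_dim TYPE('e)"
    and le: "\<And>w. inj_norm w \<le> 1 \<Longrightarrow> tensor_pair id_blinfun id_blinfun v w \<le> c"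
  shows "proj_norm v \<le> c"
proof -
  let ?P = "tensor_pair id_blinfun id_blinfun v"
  have lin: "linear ?P"
    using linear_tensor_pair[of "bilin_transpose id_blinfun" "bilin_transpose id_blinfun" v]
    by (simp add: tensor_pair_transpose)
  have c: "0 \<le> c"
    using le[of 0] inj_norm_scale[of 0 "0 :: ('e, 'f) tensor"] by (simp add: linear_0[OF lin])
  have Pw: "?P w \<le> c * r" if r: "inj_norm w \<le> r" "0 < r" for w r
  proof -
    have "inj_norm (inverse r *\<^sub>R w) \<le> inverse r * inj_norm w"
      using inj_norm_scale[of "inverse r" w] r by simp
    also have "\<dots> \<le> 1" using r by (simp add: field_simps)
    finally have "?P (inverse r *\<^sub>R w) \<le> c" by (rule le)
    with r show ?thesis by (simp add: linear_scale[OF lin] field_simps)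
  qed
  \<comment> \<open>Scaling by the injective norm fails where it vanishes; there any small positive \<open>r\<close> will do.\<close>
  have Pinj: "?P w \<le> c * inj_norm w" for w
  proof (cases "inj_norm w = 0")
    case False
    then show ?thesis using Pw[of w "inj_norm w"] inj_norm_nonneg[of w] by simp
  next
    case True
    have "?P w \<le> 0"
    proof (rule field_le_epsilon)
      fix e :: real assume e: "0 < e"
      have "?P w \<le> c * (e / (c + 1))" using e c True by (intro Pw) auto
      also have "\<dots> \<le> 0 + e" using e c by (simp add: field_simps)
      finally show "?P w \<le> 0 + e" .
    qed
    with True show ?thesis by simp
  qed
  have main: "(1 - e) * proj_norm v \<le> c" if e: "0 < e" "e < 1" for e
  proof -
    obtain X :: "('e \<Rightarrow>\<^sub>L real) set" where X: "finite X" "\<And>\<xi>. \<xi> \<in> X \<Longrightarrow> norm \<xi> \<le> 1"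
        "\<And>\<xi>. norm \<xi> \<le> 1 \<Longrightarrow> \<exists>\<zeta>\<in>X. norm (\<xi> - \<zeta>) < e"
      using finite_net_dual_ball[OF fin e(1)] by blast
    from X(1) obtain n and h :: "nat \<Rightarrow> 'e \<Rightarrow>\<^sub>L real" where h: "X = h ` {i. i < n}"
      using finite_imp_nat_seg_image_inj_on by blast
    define J :: "('e, 'f) tensor \<Rightarrow> nat \<Rightarrow>\<^sub>C 'f" where "J w = cutoff n (\<lambda>i. contract (h i) w)" for w
    have linJ: "linear J"
      by (rule linearI; rule bcontfun_eqI)
        (simp_all add: J_def linear_add[OF linear_contract] linear_scale[OF linear_contract])
    have inj: "(1 - e) * inj_norm w \<le> norm (J w)" for w
    proof -
      have "inj_norm w \<le> norm (J w) + e * inj_norm w"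
      proof (rule inj_norm_least)
        fix \<xi> :: "'e \<Rightarrow>\<^sub>L real" and \<eta> :: "'f \<Rightarrow>\<^sub>L real"
        assume \<xi>\<eta>: "norm \<xi> \<le> 1" "norm \<eta> \<le> 1"
        from X(3)[OF \<xi>\<eta>(1)] obtain i where i: "i < n" "norm (\<xi> - h i) < e" by (auto simp: h)
        have "tensor_form \<xi> \<eta> w = tensor_form (h i) \<eta> w + tensor_form (\<xi> - h i) \<eta> w"
          by (simp add: bilinear_lsub[OF bilinear_tensor_form])
        moreover have "\<bar>tensor_form (h i) \<eta> w\<bar> \<le> norm (J w)"
        proof -
          have "\<bar>tensor_form (h i) \<eta> w\<bar> \<le> norm \<eta> * norm (contract (h i) w)"
            using norm_blinfun[of \<eta> "contract (h i) w"] by (simp add: blinfun_contract)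
          also have "\<dots> \<le> norm (contract (h i) w)"
            using \<xi>\<eta>(2) by (simp add: mult_left_le_one_le)
          also have "\<dots> \<le> norm (J w)"
            using norm_bounded[of "J w" i] i by (simp add: J_def)
          finally show ?thesis .
        qed
        moreover have "\<bar>tensor_form (\<xi> - h i) \<eta> w\<bar> \<le> e * inj_norm w"
        proof -
          have "norm (\<xi> - h i) * norm \<eta> \<le> e * 1"
            using i \<xi>\<eta> e by (intro mult_mono) auto
          then have "norm (\<xi> - h i) * norm \<eta> * inj_norm w \<le> e * inj_norm w"
            by (intro mult_right_mono inj_norm_nonneg) simp
          with tensor_form_bound[of "\<xi> - h i" \<eta> w] show ?thesis by linarith
        qed
        ultimately show "\<bar>tensor_form \<xi> \<eta> w\<bar> \<le> norm (J w) + e * inj_norm w" by linarith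
      qed
      then show ?thesis by (simp add: algebra_simps)
    qed
    define C where "C = c / (1 - e)"
    have C: "0 \<le> C" using c e by (simp add: C_def)
    have PJ: "?P w \<le> C * norm (J w)" for w
    proof -
      have "c * inj_norm w \<le> c * (norm (J w) / (1 - e))"
        using inj[of w] e by (intro mult_left_mono c) (simp add: field_simps)
      with Pinj[of w] show ?thesis by (simp add: C_def)
    qed
    have "sublinear (\<lambda>z :: nat \<Rightarrow>\<^sub>C 'f. C * norm z)"
      using C by (auto simp: sublinear_def distrib_left[symmetric] norm_triangle_ineq mult_left_mono)
    from hahn_banach[OF this linJ lin PJ] obtain g where
      g: "linear g" "\<And>z. g z \<le> C * norm z" "\<And>w. g (J w) = ?P w" by blast
    obtain \<eta> :: "nat \<Rightarrow> 'f \<Rightarrow>\<^sub>L real" where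
      \<eta>: "\<And>f. g (cutoff n f) = (\<Sum>i<n. \<eta> i (f i))" "(\<Sum>i<n. norm (\<eta> i)) \<le> C"
      using functional_on_finite_sequences[OF g(1,2) C] by metis
    have "v = (\<Sum>i<n. h i \<otimes> \<eta> i)"
    proof (rule tensor_pair_separates[OF fin])
      fix w
      have "?P w = (\<Sum>i<n. tensor_form (h i) (\<eta> i) w)"
        using \<eta>(1)[of "\<lambda>i. contract (h i) w"] g(3)[of w] by (simp add: J_def blinfun_contract)
      then show "?P w = tensor_pair id_blinfun id_blinfun (\<Sum>i<n. h i \<otimes> \<eta> i) w"
        by (simp add: linear_sum[OF linear_tensor_pair])
    qed
    also have "proj_norm (\<Sum>i<n. h i \<otimes> \<eta> i) \<le> (\<Sum>i<n. norm (h i) * norm (\<eta> i))"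
    proof -
      have "(\<Sum>i<n. h i \<otimes> \<eta> i) = (\<Sum>(x, y)\<leftarrow>map (\<lambda>i. (h i, \<eta> i)) [0..<n]. x \<otimes> y)"
        by (simp add: o_def interv_sum_list_conv_sum_set_nat atLeast0LessThan)
      moreover have "(\<Sum>(x, y)\<leftarrow>map (\<lambda>i. (h i, \<eta> i)) [0..<n]. norm x * norm y)
          = (\<Sum>i<n. norm (h i) * norm (\<eta> i))"
        by (simp add: o_def interv_sum_list_conv_sum_set_nat atLeast0LessThan)
      ultimately show ?thesis using proj_norm_le[of "map (\<lambda>i. (h i, \<eta> i)) [0..<n]"] by (simp only:)
    qed
    also have "\<dots> \<le> (\<Sum>i<n. norm (\<eta> i))"
      using X(2) by (intro sum_mono) (auto simp: h mult_left_le_one_le)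
    also note \<eta>(2)
    finally show ?thesis using e by (simp add: C_def field_simps)
  qed
  show ?thesis
  proof (rule field_le_epsilon)
    fix d :: real assume d: "0 < d"
    define e where "e = min (1/2) (d / (proj_norm v + 1))"
    have e: "0 < e" "e < 1" "e \<le> d / (proj_norm v + 1)"
      using d proj_norm_nonneg[of v] by (auto simp: e_def)
    have "e * proj_norm v \<le> e * (proj_norm v + 1)" using e by simp
    also have "\<dots> \<le> d" using e(3) proj_norm_nonneg[of v] by (simp add: field_simps)
    finally show "proj_norm v \<le> c + d" using main[OF e(1,2)] by (simp add: algebra_simps)
  qed
qed

section \<open>Comparison of the constants\<close>

lemma K_G_upper:
  fixes A :: "'e::banach \<Rightarrow>\<^sub>L 'e \<Rightarrow>\<^sub>L real" and u :: "('e, 'f::banach) tensor"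
  assumes "norm A \<le> 1" "inj_norm u \<le> 1"
  shows "ennreal (proj_norm (tensor_map (blinfun_apply A) id u)) \<le> K_G TYPE('e) TYPE('f)"
  unfolding K_G_def inj_proj_opnorm_def using assms
  by (intro SUP_upper2[of A] SUP_upper2[of u]) auto

lemma K_G_least:
  assumes "\<And>(A :: 'e::banach \<Rightarrow>\<^sub>L 'e \<Rightarrow>\<^sub>L real) (u :: ('e, 'f::banach) tensor). norm A \<le> 1 \<Longrightarrow> inj_norm u \<le> 1 \<Longrightarrow>
    ennreal (proj_norm (tensor_map (blinfun_apply A) id u)) \<le> K"
  shows "K_G TYPE('e) TYPE('f) \<le> K"
  unfolding K_G_def inj_proj_opnorm_def using assms by (intro SUP_least) auto

lemma tensor_map_id: "tensor_map id id u = u"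
proof (rule tensor_linear_eqI[of _ "\<lambda>u. u"])
  show "linear (tensor_map id id)" by (intro linear_tensor_map) (simp_all add: id_def linear_iff)
  show "tensor_map id id (x \<otimes> y) = x \<otimes> y" for x :: 'a and y :: 'b
    by (subst tensor_map_elem) (simp_all add: id_def linear_iff)
qed (simp add: linear_iff)

lemma rho_eq: "rho TYPE('e::banach) TYPE('f::banach)
    = (SUP u \<in> {u :: ('e, 'f) tensor. inj_norm u \<le> 1}. ennreal (proj_norm u))"
  by (simp add: rho_def inj_proj_opnorm_def tensor_map_id)

text \<open>
  The symmetry that identifies the constants of \<open>F\<close> and \<open>F*\<close>: both sides are the pairing of \<open>u\<close> and \<open>w\<close>
  twisted by \<open>A\<close>, read from either argument.
\<close>

lemma tensor_pair_map_transpose: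
  "tensor_pair id_blinfun k (tensor_map (blinfun_apply A) id u) w
    = tensor_pair id_blinfun (bilin_transpose k) (tensor_map (blinfun_apply (bilin_transpose A)) id w) u"
  by (simp add: tensor_pair_map tensor_pair_transpose)

lemma bilin_transpose_twice [simp]: "bilin_transpose (bilin_transpose A) = A"
  by (intro blinfun_eqI) simp

lemma norm_id_le: "norm (id_blinfun :: ('a::real_normed_vector) \<Rightarrow>\<^sub>L 'a) \<le> 1"
  by (rule norm_blinfun_bound) auto

text \<open>
  The projective norm on \<open>E* \<otimes> F*\<close> is tested on \<open>w \<in> E \<otimes> F\<close>, and transposing the pairing turns each
  test into an instance of the constant for \<open>F\<close>.
\<close>

lemma K_G_dual_le:
  assumes fin: "finite_dim TYPE('e::banach)"
  shows "K_G TYPE('e) TYPE('f::banach \<Rightarrow>\<^sub>L real) \<le> K_G TYPE('e) TYPE('f)"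
proof (rule K_G_least)
  fix A :: "'e \<Rightarrow>\<^sub>L 'e \<Rightarrow>\<^sub>L real" and u :: "('e, 'f \<Rightarrow>\<^sub>L real) tensor"
  assume A: "norm A \<le> 1" and u: "inj_norm u \<le> 1"
  have A': "norm (bilin_transpose A) \<le> 1" using A norm_bilin_transpose order_trans by blast
  have k: "norm (bilin_transpose id_blinfun :: 'f \<Rightarrow>\<^sub>L ('f \<Rightarrow>\<^sub>L real) \<Rightarrow>\<^sub>L real) \<le> 1"
    using norm_bilin_transpose norm_id_le order_trans by blast
  show "ennreal (proj_norm (tensor_map (blinfun_apply A) id u)) \<le> K_G TYPE('e) TYPE('f)"
  proof (cases "K_G TYPE('e) TYPE('f)")
    case (real c)
    have "proj_norm (tensor_map (blinfun_apply A) id u) \<le> c"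
    proof (rule proj_norm_le_of_pairing[OF fin])
      fix w :: "('e, 'f) tensor" assume w: "inj_norm w \<le> 1"
      let ?w = "tensor_map (blinfun_apply (bilin_transpose A)) id w"
      have "tensor_pair id_blinfun id_blinfun (tensor_map (blinfun_apply A) id u) w
          = tensor_pair id_blinfun (bilin_transpose id_blinfun) ?w u"
        by (rule tensor_pair_map_transpose)
      also have "\<dots> \<le> inj_norm u * proj_norm ?w"
        using tensor_pair_bound[OF norm_id_le k, of ?w u] by simp
      also have "\<dots> \<le> proj_norm ?w"
        using u by (simp add: mult_left_le_one_le inj_norm_nonneg proj_norm_nonneg)
      also have "\<dots> \<le> c"
        using K_G_upper[OF A' w] real by simp
      finally show "tensor_pair id_blinfun id_blinfun (tensor_map (blinfun_apply A) id u) w \<le> c" .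
    qed
    with real show ?thesis by (simp add: ennreal_leI)
  qed simp
qed

text \<open>
  The mirror image of the previous argument: the projective norm on \<open>E* \<otimes> F\<close> is tested on
  \<open>u \<in> E \<otimes> F*\<close>.
\<close>

lemma K_G_le_dual:
  assumes fin: "finite_dim TYPE('e::banach)"
  shows "K_G TYPE('e) TYPE('f::banach) \<le> K_G TYPE('e) TYPE('f \<Rightarrow>\<^sub>L real)"
proof (rule K_G_least)
  fix A :: "'e \<Rightarrow>\<^sub>L 'e \<Rightarrow>\<^sub>L real" and w :: "('e, 'f) tensor"
  assume A: "norm A \<le> 1" and w: "inj_norm w \<le> 1"
  have A': "norm (bilin_transpose A) \<le> 1" using A norm_bilin_transpose order_trans by blast
  obtain u :: "('e, 'f \<Rightarrow>\<^sub>L real) tensor" where u: "inj_norm u \<le> 1"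
      "tensor_pair id_blinfun (bilin_transpose id_blinfun) (tensor_map (blinfun_apply A) id w) u
        = proj_norm (tensor_map (blinfun_apply A) id w)"
    using proj_norm_attained_by_pairing[OF fin] by blast
  let ?u = "tensor_map (blinfun_apply (bilin_transpose A)) id u"
  have "proj_norm (tensor_map (blinfun_apply A) id w) = tensor_pair id_blinfun id_blinfun ?u w"
    using tensor_pair_map_transpose[of "bilin_transpose id_blinfun" A w u] u(2) by simp
  also have "\<dots> \<le> inj_norm w * proj_norm ?u"
    using tensor_pair_bound[OF norm_id_le norm_id_le, of ?u w] by simp
  also have "\<dots> \<le> proj_norm ?u"
    using w by (simp add: mult_left_le_one_le inj_norm_nonneg proj_norm_nonneg)
  finally have "ennreal (proj_norm (tensor_map (blinfun_apply A) id w)) \<le> ennreal (proj_norm ?u)"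
    by (rule ennreal_leI)
  also have "\<dots> \<le> K_G TYPE('e) TYPE('f \<Rightarrow>\<^sub>L real)" by (rule K_G_upper[OF A' u(1)])
  finally show "ennreal (proj_norm (tensor_map (blinfun_apply A) id w)) \<le> K_G TYPE('e) TYPE('f \<Rightarrow>\<^sub>L real)" .
qed

lemma K_G_le_rho: "K_G TYPE('e::banach) TYPE('f::banach) \<le> rho TYPE('e) TYPE('f)"
proof (rule K_G_least)
  fix A :: "'e \<Rightarrow>\<^sub>L 'e \<Rightarrow>\<^sub>L real" and u :: "('e, 'f) tensor"
  assume A: "norm A \<le> 1" and u: "inj_norm u \<le> 1"
  have "proj_norm (tensor_map (blinfun_apply A) id u) \<le> proj_norm u"
  proof (rule proj_norm_tensor_map_le)
    show "linear (blinfun_apply A)" by (auto simp: linear_iff blinfun.add_right blinfun.scaleR_right)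
    show "norm (A x) \<le> norm x" for x
      using norm_blinfun[of A x] A by (meson mult_left_le_one_le norm_ge_zero order_trans)
  qed
  then show "ennreal (proj_norm (tensor_map (blinfun_apply A) id u)) \<le> rho TYPE('e) TYPE('f)"
    using u unfolding rho_eq by (intro SUP_upper2[of u] ennreal_leI) auto
qed

text \<open>
  The Riesz map \<open>A\<close> has norm at most 1, and so has its inverse \<open>R\<close>. As \<open>R \<otimes> id\<close> undoes \<open>A \<otimes> id\<close> without
  increasing the projective norm, this single \<open>A\<close> already recovers all of \<open>rho\<close>.
\<close>

lemma rho_euclidean_le_K_G:
  "rho TYPE('e::euclidean_space) TYPE('f::banach) \<le> K_G TYPE('e) TYPE('f)"
  unfolding rho_eq
proof (rule SUP_least)
  fix u :: "('e, 'f) tensor" assume "u \<in> {u. inj_norm u \<le> 1}"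
  then have u: "inj_norm u \<le> 1" by simp
  define A :: "'e \<Rightarrow>\<^sub>L 'e \<Rightarrow>\<^sub>L real" where "A = Blinfun blinfun_inner_right"
  have A: "A x = blinfun_inner_right x" for x
    by (simp add: A_def bounded_linear_Blinfun_apply bounded_linear_blinfun_inner_right)
  have "norm (blinfun_inner_right x) \<le> norm x" for x :: 'e
    by (rule norm_blinfun_bound) (auto simp: Cauchy_Schwarz_ineq2)
  then have nA: "norm A \<le> 1" by (auto intro: norm_blinfun_bound simp del: blinfun_inner_right.rep_eq simp: A)
  define R :: "('e \<Rightarrow>\<^sub>L real) \<Rightarrow> 'e" where "R \<xi> = (\<Sum>b\<in>Basis. \<xi> b *\<^sub>R b)" for \<xi>
  have linR: "linear R"
    by (rule linearI) (simp_all add: R_def blinfun.add_left blinfun.scaleR_left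
        scaleR_add_left sum.distrib scaleR_sum_right)
  have riesz: "R \<xi> \<bullet> x = \<xi> x" for \<xi> x
  proof -
    have "\<xi> x = \<xi> (\<Sum>b\<in>Basis. (x \<bullet> b) *\<^sub>R b)" by (simp only: euclidean_representation)
    also have "\<dots> = (\<Sum>b\<in>Basis. (x \<bullet> b) * \<xi> b)"
      by (simp add: blinfun.sum_right blinfun.scaleR_right)
    also have "\<dots> = R \<xi> \<bullet> x"
      by (simp add: R_def inner_sum_left inner_commute[of x] mult.commute)
    finally show ?thesis ..
  qed
  have R: "norm (R \<xi>) \<le> norm \<xi>" for \<xi>
  proof (cases "R \<xi> = 0")
    case False
    have "norm (R \<xi>) * norm (R \<xi>) = R \<xi> \<bullet> R \<xi>" by (simp add: power2_norm_eq_inner[symmetric] power2_eq_square)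
    also have "\<dots> = \<xi> (R \<xi>)"
      by (rule riesz)
    also have "\<dots> \<le> norm \<xi> * norm (R \<xi>)" using norm_blinfun[of \<xi> "R \<xi>"] by simp
    finally show ?thesis using False by simp
  qed simp
  have RA: "R (A x) = x" for x by (simp add: R_def A euclidean_representation)
  have linA: "linear (blinfun_apply A)" by (auto simp: linear_iff blinfun.add_right blinfun.scaleR_right)
  have id: "linear (id :: 'f \<Rightarrow> 'f)" by (simp add: id_def linear_iff)
  have "tensor_map R id (tensor_map (blinfun_apply A) id u) = u"
    by (rule tensor_linear_eqI[of "\<lambda>u. tensor_map R id (tensor_map (blinfun_apply A) id u)" "\<lambda>u. u"])
      (use linear_compose[OF linear_tensor_map[OF linA id] linear_tensor_map[OF linR id]] in
        \<open>simp_all add: o_def linear_iff RA tensor_map_elem[OF linA id] tensor_map_elem[OF linR id]\<close>)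
  with proj_norm_tensor_map_le[OF linR R, of "tensor_map (blinfun_apply A) id u"]
  have "ennreal (proj_norm u) \<le> ennreal (proj_norm (tensor_map (blinfun_apply A) id u))"
    by (simp add: ennreal_leI)
  also have "\<dots> \<le> K_G TYPE('e) TYPE('f)" by (rule K_G_upper[OF nA u])
  finally show "ennreal (proj_norm u) \<le> K_G TYPE('e) TYPE('f)" .
qed

theorem lemma3p4:
  assumes "finite_dim TYPE('e::banach)"
  shows "K_G TYPE('e) TYPE('f::banach \<Rightarrow>\<^sub>L real) = K_G TYPE('e) TYPE('f)
    \<and> K_G TYPE('e) TYPE('f) \<le> min (rho TYPE('e) TYPE('f)) (rho TYPE('e) TYPE('f \<Rightarrow>\<^sub>L real))
    \<and> K_G TYPE(real ^ 'n) TYPE('f) = rho TYPE(real ^ 'n) TYPE('f)"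
proof (intro conjI min.boundedI antisym)
  show "K_G TYPE('e) TYPE('f \<Rightarrow>\<^sub>L real) \<le> K_G TYPE('e) TYPE('f)"
    by (rule K_G_dual_le[OF assms])
  show dual: "K_G TYPE('e) TYPE('f) \<le> K_G TYPE('e) TYPE('f \<Rightarrow>\<^sub>L real)"
    by (rule K_G_le_dual[OF assms])
  show "K_G TYPE('e) TYPE('f) \<le> rho TYPE('e) TYPE('f)"
    by (rule K_G_le_rho)
  show "K_G TYPE('e) TYPE('f) \<le> rho TYPE('e) TYPE('f \<Rightarrow>\<^sub>L real)"
    by (rule order_trans[OF dual K_G_le_rho])
  show "K_G TYPE(real ^ 'n) TYPE('f) \<le> rho TYPE(real ^ 'n) TYPE('f)"
    by (rule K_G_le_rho)
  show "rho TYPE(real ^ 'n) TYPE('f) \<le> K_G TYPE(real ^ 'n) TYPE('f)"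
    by (rule rho_euclidean_le_K_G)
qed

end
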